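(* Let ancillae $A_1,\dots,A_n$ ($n\ge2$) consecutively measure a $d$-dimensional prepared quantum system $Q$, and let detectors $D_1,\dots,D_n$ amplify them. Then $$S(D_n:D_{n-1}\cdots D_1)\le S(A_n:A_{n-1}\cdots A_1)-\Sigma_n,$$ where $\Sigma_n=S(A_{n-1}|A_n)\ge0$ (computed in the unamplified state), the left side being computed in the amplified state and $S(A_n:A_{n-1}\cdots A_1)$ in the unamplified state.
   Context: $Q$ is $d$-dimensional, initially in $|Q\rangle=\sum_{x_1}\alpha^{(1)}_{x_1}|\widetilde{x}_1\rangle$. Ancilla $A_i$ ($d$-dimensional, basis $\{|x\rangle\}$, initially $|0\rangle$) measures $Q$ in the orthonormal basis $\{|\widetilde{x}_i\rangle\}$ via $\sum_x|\widetilde{x}_i\rangle\langle\widetilde{x}_i|\otimes U_x$, $U_x|0\rangle=|x\rangle$; with unitary $U^{(i)}_{x_{i-1}x_i}=\langle\widetilde{x}_i|\widetilde{x}_{i-1}\rangle$ the unamplified state is $\sum_{x_1,\dots,x_n}\alpha^{(1)}_{x_1}U^{(2)}_{x_1x_2}\cdots U^{(n)}_{x_{n-1}x_n}|\widetilde{x}_n\rangle_Q|x_1\rangle_{A_1}\cdots|x_n\rangle_{A_n}$. Amplification: detector $D_i$ (initially $|0\rangle$) copies $A_i$, $|x\rangle_{A_i}|0\rangle_{D_i}\mapsto|x\rangle_{A_i}|x\rangle_{D_i}$. Entropies are von Neumann (log base $d$) of reduced states; $S(X|Y)=S(XY)-S(Y)$, $S(X:Y)=S(X)+S(Y)-S(XY)$.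 *)

theory Defs
  imports "Jordan_Normal_Form.Char_Poly"
begin

text \<open>Registers are numbered: position 0 is Q, position i (1 \<le> i \<le> n) is ancilla A_i,
 position n+i is detector D_i; total number of registers is 2n+1, each d-dimensional.
 A computational-basis configuration is a function from positions to digits.\<close>

text \<open>k-th basis configuration of the registers in the finite set X (mixed-radix digits,
 digit for the register of rank r in X is k div d^r mod d; 0 outside X).\<close>
definition enc :: "nat \<Rightarrow> nat set \<Rightarrow> nat \<Rightarrow> (nat \<Rightarrow> nat)" where
  "enc d X k = (\<lambda>p. if p \<in> X then k div d ^ card {q\<in>X. q < p} mod d else 0)"

definition reduced :: "nat \<Rightarrow> nat \<Rightarrow> ((nat \<Rightarrow> nat) \<Rightarrow> complex) \<Rightarrow> nat set \<Rightarrow> complex mat" where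
  "reduced d N psi X = (let Y = {0..<N} - X in
     mat (d ^ card X) (d ^ card X)
       (\<lambda>(i,j). \<Sum>k<d ^ card Y. psi (\<lambda>p. enc d X i p + enc d Y k p)
                      * cnj (psi (\<lambda>p. enc d X j p + enc d Y k p))))"

definition vn_entropy :: "nat \<Rightarrow> complex mat \<Rightarrow> real" where
  "vn_entropy d A = - (\<Sum>z\<in>{z. poly (char_poly A) z = 0}.
      real (order z (char_poly A)) * (Re z * log (real d) (Re z)))"

definition ent :: "nat \<Rightarrow> nat \<Rightarrow> ((nat \<Rightarrow> nat) \<Rightarrow> complex) \<Rightarrow> nat set \<Rightarrow> real" where
  "ent d N psi X = vn_entropy d (reduced d N psi X)"

definition cond_ent :: "nat \<Rightarrow> nat \<Rightarrow> ((nat \<Rightarrow> nat) \<Rightarrow> complex) \<Rightarrow> nat set \<Rightarrow> nat set \<Rightarrow> real" where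
  "cond_ent d N psi X Y = ent d N psi (X \<union> Y) - ent d N psi Y"

definition mutual_info :: "nat \<Rightarrow> nat \<Rightarrow> ((nat \<Rightarrow> nat) \<Rightarrow> complex) \<Rightarrow> nat set \<Rightarrow> nat set \<Rightarrow> real" where
  "mutual_info d N psi X Y = ent d N psi X + ent d N psi Y - ent d N psi (X \<union> Y)"

text \<open>b i x q: q-th computational component of the basis vector |x~_i>.
  U i x y = U^(i)_{xy} = <x~_i = y | x~_{i-1} = x>.\<close>
definition Umat :: "nat \<Rightarrow> (nat \<Rightarrow> nat \<Rightarrow> nat \<Rightarrow> complex) \<Rightarrow> nat \<Rightarrow> nat \<Rightarrow> nat \<Rightarrow> complex" where
  "Umat d b i x y = (\<Sum>q<d. cnj (b i y q) * b (i - 1) x q)"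

definition amp :: "nat \<Rightarrow> nat \<Rightarrow> (nat \<Rightarrow> complex) \<Rightarrow> (nat \<Rightarrow> nat \<Rightarrow> nat \<Rightarrow> complex) \<Rightarrow> (nat \<Rightarrow> nat) \<Rightarrow> complex" where
  "amp d n \<alpha> b c = \<alpha> (c 1) * (\<Prod>i\<in>{2..n}. Umat d b i (c (i - 1)) (c i)) * b n (c n) (c 0)"

definition unamplified :: "nat \<Rightarrow> nat \<Rightarrow> (nat \<Rightarrow> complex) \<Rightarrow> (nat \<Rightarrow> nat \<Rightarrow> nat \<Rightarrow> complex) \<Rightarrow> (nat \<Rightarrow> nat) \<Rightarrow> complex" where
  "unamplified d n \<alpha> b c = (if \<forall>i\<in>{1..n}. c (n + i) = 0 then amp d n \<alpha> b c else 0)"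

definition amplified :: "nat \<Rightarrow> nat \<Rightarrow> (nat \<Rightarrow> complex) \<Rightarrow> (nat \<Rightarrow> nat \<Rightarrow> nat \<Rightarrow> complex) \<Rightarrow> (nat \<Rightarrow> nat) \<Rightarrow> complex" where
  "amplified d n \<alpha> b c = (if \<forall>i\<in>{1..n}. c (n + i) = c i then amp d n \<alpha> b c else 0)"

end

theory Submission
  imports Defs "Jordan_Normal_Form.Schur_Decomposition"
begin

text \<open>The detectors are classical: writing \<open>p\<close> for the joint distribution of the outcomes, the left side is
  \<open>H(x\<^sub>n) + H(x\<^sub>1 \<dots> x\<^sub>n\<^sub>-\<^sub>1) - H(x\<^sub>1 \<dots> x\<^sub>n)\<close>, and since \<open>x\<^sub>n\<close> depends on the past only through \<open>x\<^sub>n\<^sub>-\<^sub>1\<close> this is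
  \<open>H(x\<^sub>n) - H(x\<^sub>n | x\<^sub>n\<^sub>-\<^sub>1)\<close>. In the unamplified state \<open>Q\<close> decoheres \<open>x\<^sub>n\<close>, so the ancillae
  \<open>A\<^sub>1 \<dots> A\<^sub>n\<close> carry one pure state per value of \<open>x\<^sub>n\<close> and have entropy \<open>H(x\<^sub>n)\<close>; likewise, by unitarity of
  the last basis change, \<open>A\<^sub>1 \<dots> A\<^sub>n\<^sub>-\<^sub>1\<close> have entropy \<open>H(x\<^sub>n\<^sub>-\<^sub>1)\<close>. The claim thus becomes
  \<open>S(A\<^sub>n\<^sub>-\<^sub>1A\<^sub>n) \<le> H(x\<^sub>n\<^sub>-\<^sub>1 x\<^sub>n)\<close>: a state has at most the entropy of its diagonal. The state of
  \<open>A\<^sub>n\<^sub>-\<^sub>1A\<^sub>n\<close> is block diagonal in \<open>x\<^sub>n\<close> with blocks of trace \<open>p(x\<^sub>n)\<close>, and the eigenvalues of a block are at most its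
  trace, which gives \<open>S(A\<^sub>n\<^sub>-\<^sub>1A\<^sub>n) \<ge> S(A\<^sub>n)\<close>.

  All spectra are read off from a decomposition of the state into orthogonal rank-one terms, using that \<open>AB\<close>
  and \<open>BA\<close> have the same nonzero eigenvalues.\<close>

section \<open>Spectral decomposition\<close>

text \<open>Sylvester's identity. The block matrix with rows \<open>X, A\<close> and
  \<open>B, 1\<close> has its determinant evaluated twice: clearing \<open>B\<close> from the right
  leaves the characteristic polynomial of \<open>A * B\<close>, clearing it from the left leaves
  that of \<open>B * A\<close>. The powers of \<open>X\<close> are determinants of scalar diagonal
  blocks.\<close>

lemma char_poly_mult_commute:
  fixes A :: "'a :: idom mat"
  assumes A: "A \<in> carrier_mat m r" and B: "B \<in> carrier_mat r m"
  shows "[:0, 1:] ^ r * char_poly (A * B) = [:0, 1:] ^ m * char_poly (B * A)"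
proof -
  let ?X = "[:0, 1:] :: 'a poly"
  let ?h = "map_mat (\<lambda>a. [:a:] :: 'a poly)"
  define M where "M = four_block_mat (?X \<cdot>\<^sub>m 1\<^sub>m m) (?h A) (?h B) (1\<^sub>m r)"
  define L where "L = four_block_mat (1\<^sub>m m) (0\<^sub>m m r) (- ?h B) (1\<^sub>m r)"
  define K where "K = four_block_mat (1\<^sub>m m) (0\<^sub>m m r) (- ?h B) (?X \<cdot>\<^sub>m 1\<^sub>m r)"
  have sum_hom: "[:sum f S:] = (\<Sum>x\<in>S. [:f x:])" for f :: "nat \<Rightarrow> 'a" and S
  proof (induction S rule: infinite_finite_induct)
    case (insert x S)
    then show ?case
      by (simp del: add_pCons add: add_pCons[where p=0 and q=0, simplified, symmetric])
  qed simp_all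
  have cp: "char_poly_matrix (C * D) = ?X \<cdot>\<^sub>m 1\<^sub>m k + - (?h C * ?h D)"
    if "C \<in> carrier_mat k l" "D \<in> carrier_mat l k" for C D k l
    using that unfolding char_poly_matrix_def
    by (intro eq_matI) (auto simp: scalar_prod_def sum_hom sum_negf ac_simps simp flip: sum_hom)
  have carM: "M \<in> carrier_mat (m + r) (m + r)" and carL: "L \<in> carrier_mat (m + r) (m + r)"
    and carK: "K \<in> carrier_mat (m + r) (m + r)"
    using A B unfolding M_def L_def K_def by auto
  have "M * L = four_block_mat (char_poly_matrix (A * B)) (?h A) (0\<^sub>m r m) (1\<^sub>m r)"
    unfolding M_def L_def cp[OF A B]
    apply (subst mult_four_block_mat[where ?nr1.0=m and ?n1.0=m and ?nc1.0=m and ?n2.0=r and ?nr2.0=r and ?nc2.0=r])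
    using A B by (auto intro!: arg_cong2[where f="\<lambda>x y. four_block_mat x y _ _"])
  then have "det (M * L) = char_poly (A * B)"
    using A B by (simp add: det_four_block_mat_lower_left_zero[where n=m and m=r] char_poly_def char_poly_matrix_closed)
  moreover have "det L = 1"
    unfolding L_def using B by (subst det_four_block_mat_upper_right_zero[where n=m and m=r]) auto
  ultimately have 1: "det M = char_poly (A * B)"
    using det_mult[OF carM carL] by simp
  have cancel: "- (?h B * (?X \<cdot>\<^sub>m 1\<^sub>m m)) + ?X \<cdot>\<^sub>m 1\<^sub>m r * ?h B = 0\<^sub>m r m"
    using B by (simp add: mult_smult_distrib[where nr=r and n=m and nc=m]
        mult_smult_assoc_mat[where nr=r and n=r and nc=m] uminus_l_inv_mat[where nr=r and nc=m])
  have comm: "- (?h B * ?h A) + ?X \<cdot>\<^sub>m 1\<^sub>m r = ?X \<cdot>\<^sub>m 1\<^sub>m r + - (?h B * ?h A)"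
    using A B by (intro comm_add_mat[where nr=r and nc=r]) auto
  have "K * M = four_block_mat (?X \<cdot>\<^sub>m 1\<^sub>m m) (?h A) (0\<^sub>m r m) (char_poly_matrix (B * A))"
    unfolding M_def K_def cp[OF B A]
    apply (subst mult_four_block_mat[where ?nr1.0=m and ?n1.0=m and ?nc1.0=m and ?n2.0=r and ?nr2.0=r and ?nc2.0=r])
    using A B by (auto simp: cancel comm)
  then have "det (K * M) = ?X ^ m * char_poly (B * A)"
    using A B by (simp add: det_four_block_mat_lower_left_zero[where n=m and m=r] char_poly_def char_poly_matrix_closed)
  moreover have "det K = ?X ^ r"
    unfolding K_def using B by (subst det_four_block_mat_upper_right_zero[where n=m and m=r]) auto
  ultimately show ?thesis
    using det_mult[OF carK carM] 1 by simp
qed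

text \<open>A left inverse of a square matrix is also a right inverse, so \<open>d\<close>
  orthonormal vectors in dimension \<open>d\<close> resolve the identity.\<close>

lemma orthonormal_complete:
  fixes v :: "nat \<Rightarrow> nat \<Rightarrow> complex"
  assumes "\<And>j k. j < d \<Longrightarrow> k < d \<Longrightarrow> (\<Sum>x<d. cnj (v j x) * v k x) = (if j = k then 1 else 0)"
    and "x < d" "y < d"
  shows "(\<Sum>k<d. v k x * cnj (v k y)) = (if x = y then 1 else 0)"
proof -
  define V where "V = mat d d (\<lambda>(x, k). v k x)"
  define W where "W = mat d d (\<lambda>(k, x). cnj (v k x))"
  have V: "V \<in> carrier_mat d d" and W: "W \<in> carrier_mat d d"
    by (auto simp: V_def W_def)
  have "W * V = 1\<^sub>m d"
    using assms(1) by (intro eq_matI) (auto simp: V_def W_def scalar_prod_def lessThan_atLeast0)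
  then have "V * W = 1\<^sub>m d"
    by (rule mat_mult_left_right_inverse[OF W V])
  then have "(V * W) $$ (x, y) = (1\<^sub>m d) $$ (x, y)"
    by simp
  then show ?thesis
    using assms(2,3) by (simp add: V_def W_def scalar_prod_def lessThan_atLeast0)
qed

text \<open>After Schur triangularisation the diagonal consists of eigenvalues, all equal to
  \<open>s\<close>, and the trace is invariant under similarity. The lemma serves contrapositively:
  a trace other than \<open>d * s\<close> yields an eigenvector for an eigenvalue other than
  \<open>s\<close>.\<close>

lemma trace_single_eigenvalue:
  fixes C :: "nat \<Rightarrow> nat \<Rightarrow> complex"
  assumes single: "\<And>\<mu> x. \<exists>i<d. x i \<noteq> 0 \<Longrightarrow> (\<And>i. i < d \<Longrightarrow> (\<Sum>j<d. C i j * x j) = \<mu> * x i) \<Longrightarrow> \<mu> = s"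
  shows "(\<Sum>i<d. C i i) = of_nat d * s"
proof -
  define A where "A = mat d d (\<lambda>(i, j). C i j)"
  have A: "A \<in> carrier_mat d d"
    by (simp add: A_def)
  obtain as where "char_poly A = (\<Prod>a\<leftarrow>as. [:- a, 1:])"
    using char_poly_factorized[OF A] by blast
  then obtain B where B: "B \<in> carrier_mat d d" and upper: "upper_triangular B" and sim: "similar_mat A B"
    using schur_decomposition_exists[OF A] by blast
  have diag: "B $$ (i, i) = s" if "i < d" for i
  proof -
    have "poly (char_poly A) (B $$ (i, i)) = 0"
      unfolding char_poly_similar[OF sim] char_poly_upper_triangular[OF B upper]
      using that B by (auto simp: poly_prod_list prod_list_zero_iff diag_mat_def)
    then obtain u where "eigenvector A u (B $$ (i, i))"
      unfolding eigenvalue_root_char_poly[OF A, symmetric] eigenvalue_def by blast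
    then have u: "u \<in> carrier_vec d" "u \<noteq> 0\<^sub>v d" "A *\<^sub>v u = B $$ (i, i) \<cdot>\<^sub>v u"
      using A by (auto simp: eigenvector_def)
    show ?thesis
    proof (rule single)
      show "\<exists>i<d. u $ i \<noteq> 0"
        using u(1,2) by (metis carrier_vecD eq_vecI index_zero_vec)
      fix j assume "j < d"
      then show "(\<Sum>k<d. C j k * u $ k) = B $$ (i, i) * u $ j"
        using arg_cong[OF u(3), of "\<lambda>w. w $ j"] u(1)
        by (simp add: A_def scalar_prod_def lessThan_atLeast0)
    qed
  qed
  obtain P Q where wit: "similar_mat_wit A B P Q"
    using sim by (auto simp: similar_mat_def)
  note PQ = similar_mat_witD2[OF A wit]
  have "(\<Sum>i<d. C i i) = (\<Sum>i<d. A $$ (i, i))"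
    by (simp add: A_def)
  also have "\<dots> = (\<Sum>i<d. \<Sum>j<d. \<Sum>k<d. P $$ (i, j) * (B $$ (j, k) * Q $$ (k, i)))"
    unfolding PQ(3) using PQ(4-7)
    by (intro sum.cong) (auto simp: scalar_prod_def lessThan_atLeast0 sum_distrib_left)
  \<comment> \<open>Cyclicity of the trace: summing over \<open>i\<close> first brings
    \<open>Q\<close> next to \<open>P\<close>, and \<open>Q * P\<close> is the identity.\<close>
  also have "\<dots> = (\<Sum>j<d. \<Sum>k<d. \<Sum>i<d. P $$ (i, j) * (B $$ (j, k) * Q $$ (k, i)))"
    by (subst sum.swap, rule sum.cong[OF refl sum.swap])
  also have "\<dots> = (\<Sum>j<d. \<Sum>k<d. B $$ (j, k) * (Q * P) $$ (k, j))"
    using PQ(4-7)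
    by (intro sum.cong refl) (auto simp: scalar_prod_def lessThan_atLeast0 sum_distrib_left ac_simps)
  also have "\<dots> = (\<Sum>j<d. B $$ (j, j))"
    using PQ(2) by (intro sum.cong refl) (simp add: if_distrib cong: if_cong)
  also have "\<dots> = of_nat d * s"
    using diag by simp
  finally show ?thesis .
qed

lemma hermitian_extend_eigenvectors:
  fixes B :: "nat \<Rightarrow> nat \<Rightarrow> complex"
  assumes herm: "\<And>x y. x < d \<Longrightarrow> y < d \<Longrightarrow> B y x = cnj (B x y)"
    and "m < d"
    and orth: "\<And>j k. j < m \<Longrightarrow> k < m \<Longrightarrow> (\<Sum>x<d. cnj (v j x) * v k x) = (if j = k then 1 else 0)"
    and eig: "\<And>k x. k < m \<Longrightarrow> x < d \<Longrightarrow> (\<Sum>y<d. B x y * v k y) = of_real (l k) * v k x"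
  obtains u :: "nat \<Rightarrow> complex" and \<mu> :: real where
    "(\<Sum>x<d. cnj (u x) * u x) = 1"
    "\<And>k. k < m \<Longrightarrow> (\<Sum>x<d. cnj (v k x) * u x) = 0"
    "\<And>x. x < d \<Longrightarrow> (\<Sum>y<d. B x y * u y) = of_real \<mu> * u x"
proof -
  \<comment> \<open>Shift the known eigenvalues to \<open>s\<close>. Unless the trace forces it, \<open>s\<close> is not the only eigenvalue,
    and an eigenvector for another one is orthogonal to all known ones.\<close>
  define s where "s = (Re (\<Sum>x<d. B x x) - (\<Sum>k<m. l k)) / (real d - real m) + 1"
  define C where "C = (\<lambda>x y. B x y + (\<Sum>k<m. of_real (s - l k) * v k x * cnj (v k y)))"
  have C_apply: "(\<Sum>y<d. C x y * u y) = (\<Sum>y<d. B x y * u y)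
      + (\<Sum>k<m. of_real (s - l k) * v k x * (\<Sum>y<d. cnj (v k y) * u y))" for x u
    unfolding C_def
    by (simp add: ring_distribs sum.distrib sum_distrib_left sum_distrib_right mult.assoc)
      (rule sum.swap)
  have C_herm: "C y x = cnj (C x y)" if "x < d" "y < d" for x y
    unfolding C_def using herm[OF that] by (simp add: ac_simps)
  have C_eig: "(\<Sum>y<d. C x y * v k y) = of_real s * v k x" if "k < m" "x < d" for k x
    using that by (simp add: C_apply orth eig if_distrib cong: if_cong) (simp add: algebra_simps)
  have "(\<Sum>x<d. C x x) = (\<Sum>x<d. B x x) + (\<Sum>k<m. of_real (s - l k) * (\<Sum>x<d. cnj (v k x) * v k x))"
    unfolding C_def
    by (simp add: sum.distrib sum_distrib_left) (subst sum.swap, simp add: ac_simps)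
  then have trace: "(\<Sum>x<d. C x x) = (\<Sum>x<d. B x x) + of_real (real m * s - (\<Sum>k<m. l k))"
    by (simp add: orth sum_subtractf)
  \<comment> \<open>Equality would make \<open>s\<close> the mean of the \<open>d - m\<close>
    eigenvalues of \<open>B\<close> still to be found; the \<open>+ 1\<close> in \<open>s\<close>
    excludes this.\<close>
  have "(\<Sum>x<d. C x x) \<noteq> of_nat d * of_real s"
  proof
    assume "(\<Sum>x<d. C x x) = of_nat d * of_real s"
    from arg_cong[OF this, of Re] have "Re (\<Sum>x<d. B x x) - (\<Sum>k<m. l k) = (real d - real m) * s"
      unfolding trace by (simp add: algebra_simps)
    moreover have "(real d - real m) * s = Re (\<Sum>x<d. B x x) - (\<Sum>k<m. l k) + (real d - real m)"
      using \<open>m < d\<close> by (simp add: s_def distrib_left)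
    ultimately show False
      using \<open>m < d\<close> by simp
  qed
  then obtain \<mu> u where \<mu>: "\<mu> \<noteq> of_real s" and u: "\<exists>x<d. u x \<noteq> 0"
    and Cu: "\<And>x. x < d \<Longrightarrow> (\<Sum>y<d. C x y * u y) = \<mu> * u x"
    using trace_single_eigenvalue[of d C "of_real s"] by blast
  \<comment> \<open>Eigenvectors of the Hermitian \<open>C\<close> for different eigenvalues are
    orthogonal. Only \<open>s\<close> has to be real for this; \<open>\<mu>\<close> is not yet known
    to be.\<close>
  have ortho: "(\<Sum>x<d. cnj (v k x) * u x) = 0" if k: "k < m" for k
  proof -
    have "\<mu> * (\<Sum>x<d. cnj (v k x) * u x) = (\<Sum>x<d. cnj (v k x) * (\<Sum>y<d. C x y * u y))"
      by (simp add: Cu) (simp add: sum_distrib_left ac_simps)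
    also have "\<dots> = (\<Sum>y<d. (\<Sum>x<d. cnj (v k x) * C x y) * u y)"
      by (simp add: sum_distrib_left sum_distrib_right ac_simps) (rule sum.swap)
    also have "\<dots> = (\<Sum>y<d. cnj (\<Sum>x<d. C y x * v k x) * u y)"
    proof (intro sum.cong refl)
      fix y assume "y \<in> {..<d}"
      then show "(\<Sum>x<d. cnj (v k x) * C x y) * u y = cnj (\<Sum>x<d. C y x * v k x) * u y"
        using C_herm[of y] by (simp add: mult.commute)
    qed
    also have "\<dots> = of_real s * (\<Sum>x<d. cnj (v k x) * u x)"
      using k by (simp add: C_eig del: cnj_sum) (simp add: sum_distrib_left ac_simps)
    finally show ?thesis
      using \<mu> by simp
  qed
  \<comment> \<open>By orthogonality the rank-one corrections in \<open>C\<close> vanish on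
    \<open>u\<close>, so \<open>u\<close> is an eigenvector of \<open>B\<close> itself.\<close>
  have Bu: "(\<Sum>y<d. B x y * u y) = \<mu> * u x" if "x < d" for x
    using Cu[OF that] by (simp add: C_apply ortho)
  define N where "N = (\<Sum>x<d. (cmod (u x))\<^sup>2)"
  have N: "(\<Sum>x<d. cnj (u x) * u x) = of_real N"
    by (simp add: N_def mult.commute[of "cnj _"] flip: complex_norm_square)
  have "N > 0"
    using u unfolding N_def by (auto intro!: sum_pos2)
  \<comment> \<open>Letting \<open>B\<close> act on either side of the inner product of
    \<open>u\<close> with itself gives \<open>\<mu>\<close> and its conjugate, so
    \<open>\<mu>\<close> is real.\<close>
  have "\<mu> * of_real N = (\<Sum>x<d. cnj (u x) * (\<Sum>y<d. B x y * u y))"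
    by (simp add: Bu flip: N) (simp add: sum_distrib_left ac_simps)
  also have "\<dots> = (\<Sum>y<d. cnj (\<Sum>x<d. B y x * u x) * u y)"
  proof -
    have "(\<Sum>x<d. cnj (u x) * (\<Sum>y<d. B x y * u y)) = (\<Sum>y<d. (\<Sum>x<d. cnj (u x) * B x y) * u y)"
      by (simp add: sum_distrib_left sum_distrib_right ac_simps) (rule sum.swap)
    also have "\<dots> = (\<Sum>y<d. cnj (\<Sum>x<d. B y x * u x) * u y)"
    proof (intro sum.cong refl)
      fix y assume "y \<in> {..<d}"
      then show "(\<Sum>x<d. cnj (u x) * B x y) * u y = cnj (\<Sum>x<d. B y x * u x) * u y"
        using herm[of y] by (simp add: mult.commute)
    qed
    finally show ?thesis .
  qed
  also have "\<dots> = cnj \<mu> * of_real N"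
    by (simp add: Bu del: cnj_sum flip: N) (simp add: sum_distrib_left ac_simps)
  finally have "\<mu> = cnj \<mu>"
    using \<open>N > 0\<close> by simp
  then have real: "\<mu> = of_real (Re \<mu>)"
    by (simp add: complex_eq_iff)
  show thesis
  proof
    show "(\<Sum>x<d. cnj (u x / of_real (sqrt N)) * (u x / of_real (sqrt N))) = 1"
      using N \<open>N > 0\<close> by (simp flip: sum_divide_distrib of_real_mult)
    show "(\<Sum>x<d. cnj (v k x) * (u x / of_real (sqrt N))) = 0" if "k < m" for k
      using ortho[OF that] by (simp flip: sum_divide_distrib)
    show "(\<Sum>y<d. B x y * (u y / of_real (sqrt N))) = of_real (Re \<mu>) * (u x / of_real (sqrt N))" if "x < d" for x
      using Bu[OF that] by (simp flip: sum_divide_distrib real)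
  qed
qed

text \<open>Induction on the number of eigenvectors found, in fixed dimension, so that no
  restriction to an orthogonal complement is needed.\<close>

lemma hermitian_eigenbasis:
  fixes B :: "nat \<Rightarrow> nat \<Rightarrow> complex"
  assumes herm: "\<And>x y. x < d \<Longrightarrow> y < d \<Longrightarrow> B y x = cnj (B x y)"
    and "m \<le> d"
  shows "\<exists>v (l :: nat \<Rightarrow> real). (\<forall>j<m. \<forall>k<m. (\<Sum>x<d. cnj (v j x) * v k x) = (if j = k then 1 else 0))
      \<and> (\<forall>k<m. \<forall>x<d. (\<Sum>y<d. B x y * v k y) = of_real (l k) * v k x)"
  using \<open>m \<le> d\<close>
proof (induction m)
  case (Suc m)
  obtain v and l :: "nat \<Rightarrow> real"
    where vl: "\<forall>j<m. \<forall>k<m. (\<Sum>x<d. cnj (v j x) * v k x) = (if j = k then 1 else 0)"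
    "\<forall>k<m. \<forall>x<d. (\<Sum>y<d. B x y * v k y) = of_real (l k) * v k x"
    using Suc.IH[OF Suc_leD[OF Suc.prems]] by (elim exE conjE) (rule that)
  then have orth: "\<And>j k. j < m \<Longrightarrow> k < m \<Longrightarrow> (\<Sum>x<d. cnj (v j x) * v k x) = (if j = k then 1 else 0)"
    and eig: "\<And>k x. k < m \<Longrightarrow> x < d \<Longrightarrow> (\<Sum>y<d. B x y * v k y) = of_real (l k) * v k x"
    by blast+
  obtain u \<mu> where u: "(\<Sum>x<d. cnj (u x) * u x) = 1"
    "\<And>k. k < m \<Longrightarrow> (\<Sum>x<d. cnj (v k x) * u x) = 0"
    "\<And>x. x < d \<Longrightarrow> (\<Sum>y<d. B x y * u y) = of_real \<mu> * u x"
    by (rule hermitian_extend_eigenvectors[of d B m v l, OF herm _ orth eig]) (use Suc.prems in auto)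
  have u': "(\<Sum>x<d. cnj (u x) * v k x) = 0" if "k < m" for k
    using arg_cong[OF u(2)[OF that], of cnj] by (simp add: mult.commute)
  show ?case
    by (rule exI[of _ "v(m := u)"], rule exI[of _ "l(m := \<mu>)"]) (auto simp: less_Suc_eq orth eig u u')
qed simp

text \<open>A sum of rank-one terms is Hermitian, and its eigenvalue at \<open>v k\<close> is the
  sum of the squared overlaps of \<open>v k\<close> with the vectors \<open>g r\<close>, hence
  nonnegative.\<close>

lemma gram_spectral_decomposition:
  fixes g :: "'r \<Rightarrow> nat \<Rightarrow> complex"
  obtains v :: "nat \<Rightarrow> nat \<Rightarrow> complex" and l :: "nat \<Rightarrow> real" where
    "\<And>j k. j < d \<Longrightarrow> k < d \<Longrightarrow> (\<Sum>x<d. cnj (v j x) * v k x) = (if j = k then 1 else 0)"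
    "\<And>x y. x < d \<Longrightarrow> y < d \<Longrightarrow> (\<Sum>k<d. v k x * cnj (v k y)) = (if x = y then 1 else 0)"
    "\<And>k. k < d \<Longrightarrow> l k \<ge> 0"
    "\<And>x y. x < d \<Longrightarrow> y < d \<Longrightarrow>
      (\<Sum>r\<in>R. g r x * cnj (g r y)) = (\<Sum>k<d. of_real (l k) * v k x * cnj (v k y))"
proof -
  define B where "B = (\<lambda>x y. \<Sum>r\<in>R. g r x * cnj (g r y))"
  have herm: "B y x = cnj (B x y)" for x y
    by (simp add: B_def mult.commute)
  obtain v and l :: "nat \<Rightarrow> real"
    where vl: "\<forall>j<d. \<forall>k<d. (\<Sum>x<d. cnj (v j x) * v k x) = (if j = k then 1 else 0)"
    "\<forall>k<d. \<forall>x<d. (\<Sum>y<d. B x y * v k y) = of_real (l k) * v k x"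
    using hermitian_eigenbasis[of d B d, OF herm order_refl] by (elim exE conjE) (rule that)
  then have orth: "\<And>j k. j < d \<Longrightarrow> k < d \<Longrightarrow> (\<Sum>x<d. cnj (v j x) * v k x) = (if j = k then 1 else 0)"
    and eig: "\<And>k x. k < d \<Longrightarrow> x < d \<Longrightarrow> (\<Sum>y<d. B x y * v k y) = of_real (l k) * v k x"
    by blast+
  have complete: "(\<Sum>k<d. v k x * cnj (v k y)) = (if x = y then 1 else 0)" if "x < d" "y < d" for x y
    using orth that by (rule orthonormal_complete)
  have "of_real (l k) = complex_of_real (\<Sum>r\<in>R. (cmod (\<Sum>x<d. cnj (v k x) * g r x))\<^sup>2)" if k: "k < d" for k
  proof -
    have "of_real (l k) = (\<Sum>x<d. cnj (v k x) * (\<Sum>y<d. B x y * v k y))"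
      using orth[OF k k] k by (simp add: eig mult.left_commute flip: sum_distrib_left)
    also have "\<dots> = (\<Sum>x<d. \<Sum>y<d. \<Sum>r\<in>R. (cnj (v k x) * g r x) * cnj (cnj (v k y) * g r y))"
      by (simp add: B_def sum_distrib_left sum_distrib_right ac_simps)
    also have "\<dots> = (\<Sum>r\<in>R. \<Sum>x<d. \<Sum>y<d. (cnj (v k x) * g r x) * cnj (cnj (v k y) * g r y))"
      by (rule trans[OF sum.cong[OF refl sum.swap] sum.swap])
    also have "\<dots> = (\<Sum>r\<in>R. (\<Sum>x<d. cnj (v k x) * g r x) * cnj (\<Sum>y<d. cnj (v k y) * g r y))"
      by (simp only: cnj_sum sum_product)
    finally show ?thesis
      by (simp del: cnj_sum flip: complex_norm_square)
  qed
  then have "l k = (\<Sum>r\<in>R. (cmod (\<Sum>x<d. cnj (v k x) * g r x))\<^sup>2)" if "k < d" for k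
    using that unfolding of_real_eq_iff .
  then have nonneg: "l k \<ge> 0" if "k < d" for k
    using that by (simp add: sum_nonneg)
  have "B x y = (\<Sum>k<d. of_real (l k) * v k x * cnj (v k y))" if "x < d" "y < d" for x y
  proof -
    \<comment> \<open>The eigenvalue equation puts \<open>B\<close> in front of the resolution of
      the identity, which then collapses.\<close>
    have "(\<Sum>k<d. of_real (l k) * v k x * cnj (v k y)) = (\<Sum>k<d. \<Sum>z<d. B x z * (v k z * cnj (v k y)))"
      using that by (simp add: sum_distrib_right mult.assoc flip: eig)
    also have "\<dots> = (\<Sum>z<d. B x z * (\<Sum>k<d. v k z * cnj (v k y)))"
      by (subst sum.swap) (simp add: sum_distrib_left)
    also have "\<dots> = B x y"
      using that by (simp add: complete if_distrib cong: if_cong)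
    finally show ?thesis ..
  qed
  note decomp = this[unfolded B_def]
  show thesis
    by (rule that[of v l]) (fact orth complete nonneg decomp)+
qed

section \<open>Entropy of a state from orthogonal rank-one terms\<close>

lemma order_prod_linear:
  fixes p :: "'b \<Rightarrow> complex"
  assumes "finite J"
  shows "Polynomial.order z (\<Prod>y\<in>J. [:- p y, 1:]) = card {y \<in> J. p y = z}"
  using assms
proof (induction J rule: finite_induct)
  case (insert x J)
  have "(\<Prod>y\<in>J. [:- p y, 1:]) \<noteq> 0"
    using insert by simp
  then have "Polynomial.order z (\<Prod>y\<in>insert x J. [:- p y, 1:]) = Polynomial.order z [:- p x, 1:] + card {y \<in> J. p y = z}"
    using insert by (simp add: order_mult del: mult_pCons_left)
  moreover have "Polynomial.order z [:- p x, 1:] = (if p x = z then 1 else 0)"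
    using order_power_n_n[of z 1] by (auto intro!: order_0I)
  moreover have "{y \<in> insert x J. p y = z} = (if p x = z then insert x {y \<in> J. p y = z} else {y \<in> J. p y = z})"
    by auto
  ultimately show ?case
    using insert by simp
qed simp

text \<open>At a nonzero \<open>z\<close> the powers of \<open>X\<close> have order 0, so the
  multiplicity of \<open>z\<close> is the number of \<open>y\<close> with \<open>p y = z\<close>. At
  \<open>z = 0\<close> the summand vanishes, whatever its multiplicity. Hence \<open>J\<close> may
  be smaller or larger than the dimension of \<open>A\<close>.\<close>

lemma vn_entropy_eq_sum:
  fixes p :: "'b \<Rightarrow> real"
  assumes "finite J"
    and cp: "[:0, 1:] ^ r * char_poly A = [:0, 1:] ^ m * (\<Prod>y\<in>J. [:- of_real (p y), 1:])"
  shows "vn_entropy d A = - (\<Sum>y\<in>J. p y * log d (p y))"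
proof -
  define q where "q = char_poly A"
  define f where "f = (\<lambda>z. Re z * log d (Re z))"
  let ?R = "\<Prod>y\<in>J. [:- complex_of_real (p y), 1:]"
  have "?R \<noteq> 0"
    using \<open>finite J\<close> by simp
  then have nz: "[:0, 1:] ^ m * ?R \<noteq> 0"
    by simp
  then have "q \<noteq> 0"
    using cp by (auto simp: q_def)
  have ord: "Polynomial.order z q = card {y \<in> J. of_real (p y) = z}" if "z \<noteq> 0" for z
  proof -
    have "Polynomial.order z ([:0, 1:] ^ k) = 0" for k
      using that by (intro order_0I) simp
    then show ?thesis
      using arg_cong[OF cp, of "Polynomial.order z"] nz \<open>q \<noteq> 0\<close> order_prod_linear[OF \<open>finite J\<close>, of z "\<lambda>y. of_real (p y)"]
      by (simp add: order_mult q_def)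
  qed
  let ?Z = "(\<lambda>y. complex_of_real (p y)) ` J"
  \<comment> \<open>The roots of \<open>q\<close> and the values of \<open>p\<close> can differ only
    in 0, where \<open>f\<close> is 0.\<close>
  have "(\<Sum>z\<in>{z. poly q z = 0}. real (Polynomial.order z q) * f z) = (\<Sum>z\<in>?Z. real (card {y \<in> J. of_real (p y) = z}) * f z)"
  proof (rule sum.mono_neutral_cong)
    show "finite {z. poly q z = 0}"
      using \<open>q \<noteq> 0\<close> by (rule poly_roots_finite)
    fix z
    show "real (card {y \<in> J. of_real (p y) = z}) * f z = 0" if "z \<in> ?Z - {z. poly q z = 0}"
      using that ord[of z] by (cases "z = 0") (auto simp: f_def order_root)
    show "real (Polynomial.order z q) * f z = 0" if "z \<in> {z. poly q z = 0} - ?Z"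
    proof (cases "z = 0")
      case False
      have "{y \<in> J. of_real (p y) = z} = {}"
        using that by auto
      then show ?thesis
        unfolding ord[OF False] by (simp only: card.empty of_nat_0 mult_zero_left)
    qed (simp add: f_def)
    show "real (Polynomial.order z q) * f z = real (card {y \<in> J. of_real (p y) = z}) * f z"
      using ord[of z] by (cases "z = 0") (auto simp: f_def)
  qed (use \<open>finite J\<close> in auto)
  also have "\<dots> = (\<Sum>z\<in>?Z. \<Sum>y | y \<in> J \<and> of_real (p y) = z. f (of_real (p y)))"
    by (intro sum.cong refl) simp
  also have "\<dots> = (\<Sum>y\<in>J. f (of_real (p y)))"
    using \<open>finite J\<close> by (intro sum.image_gen[symmetric])
  finally show ?thesis
    by (simp add: vn_entropy_def q_def f_def)
qed

text \<open>With the \<open>w y\<close> as columns of \<open>A\<close>, the state is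
  \<open>A\<close> times its adjoint, while the product in the other order is diagonal with entries
  \<open>p y\<close>. The vectors are not normalised: \<open>p y\<close> is the squared norm of
  \<open>w y\<close>, and it may be 0.\<close>

lemma vn_entropy_gram:
  fixes p :: "'b \<Rightarrow> real" and w :: "'b \<Rightarrow> nat \<Rightarrow> complex"
  assumes "finite J" and rho: "\<rho> \<in> carrier_mat m m"
    and gram: "\<And>i j. i < m \<Longrightarrow> j < m \<Longrightarrow> \<rho> $$ (i, j) = (\<Sum>y\<in>J. w y i * cnj (w y j))"
    and orth: "\<And>x y. x \<in> J \<Longrightarrow> y \<in> J \<Longrightarrow> (\<Sum>i<m. cnj (w x i) * w y i) = (if x = y then of_real (p x) else 0)"
  shows "vn_entropy d \<rho> = - (\<Sum>y\<in>J. p y * log d (p y))"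
proof -
  define r where "r = card J"
  obtain h where h: "bij_betw h {..<r} J"
    using ex_bij_betw_nat_finite[OF \<open>finite J\<close>] by (auto simp: r_def lessThan_atLeast0)
  then have hJ: "h k \<in> J" if "k < r" for k
    using that by (auto simp: bij_betw_def)
  have hinj: "h k = h l \<longleftrightarrow> k = l" if "k < r" "l < r" for k l
    using that h by (auto simp: bij_betw_def inj_on_def)
  define A where "A = mat m r (\<lambda>(i, k). w (h k) i)"
  define B where "B = mat r m (\<lambda>(k, i). cnj (w (h k) i))"
  have A: "A \<in> carrier_mat m r" and B: "B \<in> carrier_mat r m"
    by (auto simp: A_def B_def)
  have "\<rho> = A * B"
  proof (rule eq_matI)
    fix i j assume "i < dim_row (A * B)" "j < dim_col (A * B)"
    then have ij: "i < m" "j < m"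
      by (auto simp: A_def B_def)
    have "\<rho> $$ (i, j) = (\<Sum>k<r. w (h k) i * cnj (w (h k) j))"
      unfolding gram[OF ij] by (rule sum.reindex_bij_betw[OF h, symmetric])
    then show "\<rho> $$ (i, j) = (A * B) $$ (i, j)"
      using ij by (simp add: A_def B_def scalar_prod_def lessThan_atLeast0)
  qed (use rho in \<open>auto simp: A_def B_def\<close>)
  have BA: "B * A = mat r r (\<lambda>(k, l). if k = l then of_real (p (h k)) else 0)"
    using orth hJ hinj by (intro eq_matI) (auto simp: A_def B_def scalar_prod_def simp flip: lessThan_atLeast0)
  have "char_poly (B * A) = (\<Prod>k<r. [:- of_real (p (h k)), 1:])"
    unfolding BA by (subst char_poly_upper_triangular[where n=r])
      (auto simp: diag_mat_def prod.list_conv_set_nth lessThan_atLeast0)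
  also have "\<dots> = (\<Prod>y\<in>J. [:- of_real (p y), 1:])"
    by (rule prod.reindex_bij_betw[OF h])
  finally show ?thesis
    using vn_entropy_eq_sum[OF \<open>finite J\<close>, of r "A * B" m p d] char_poly_mult_commute[OF A B] \<open>\<rho> = A * B\<close>
    by simp
qed

section \<open>Entropy inequalities\<close>

text \<open>Each \<open>l k\<close> is at most the sum and the logarithm is monotone. This bounds
  the spectrum of a block against its trace.\<close>

lemma sum_entropy_le_total:
  fixes l :: "'a \<Rightarrow> real"
  assumes "finite K" "b > 1" and nonneg: "\<And>k. k \<in> K \<Longrightarrow> l k \<ge> 0"
  shows "(\<Sum>k\<in>K. l k * log b (l k)) \<le> sum l K * log b (sum l K)"
  unfolding sum_distrib_right
proof (intro sum_mono)
  fix k assume k: "k \<in> K"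
  show "l k * log b (l k) \<le> l k * log b (sum l K)"
  proof (cases "l k = 0")
    case False
    then have "0 < l k" "l k \<le> sum l K"
      using nonneg k assms(1) by (force intro: member_le_sum)+
    then show ?thesis
      using \<open>b > 1\<close> by simp
  qed simp
qed

text \<open>Doubly stochastic mixing does not lower entropy. It is applied with \<open>l\<close> a
  spectrum, \<open>q\<close> the diagonal and \<open>D\<close> the squared moduli of the eigenvector
  entries.\<close>

lemma sum_entropy_doubly_stochastic:
  fixes l :: "'a \<Rightarrow> real" and D :: "'a \<Rightarrow> 'b \<Rightarrow> real"
  assumes "finite K" "finite X" "b > 1"
    and l: "\<And>k. k \<in> K \<Longrightarrow> l k \<ge> 0"
    and D: "\<And>k x. k \<in> K \<Longrightarrow> x \<in> X \<Longrightarrow> D k x \<ge> 0"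
    and rows: "\<And>k. k \<in> K \<Longrightarrow> (\<Sum>x\<in>X. D k x) = 1"
    and cols: "\<And>x. x \<in> X \<Longrightarrow> (\<Sum>k\<in>K. D k x) = 1"
    and q: "\<And>x. x \<in> X \<Longrightarrow> q x = (\<Sum>k\<in>K. l k * D k x)"
  shows "(\<Sum>x\<in>X. q x * log b (q x)) \<le> (\<Sum>k\<in>K. l k * log b (l k))"
proof -
  have "ln b > 0"
    using \<open>b > 1\<close> by simp
  \<comment> \<open>This is \<open>ln s \<le> s - 1\<close> at \<open>s = q x / l k\<close>.
    Weighted by \<open>D k x\<close> and summed, the linear correction
    \<open>(l k - q x) / ln b\<close> cancels because the rows and columns of \<open>D\<close> sum
    to 1.\<close>
  have pointwise: "D k x * (l k * log b (l k)) \<ge> D k x * (l k * log b (q x) + (l k - q x) / ln b)"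
    if k: "k \<in> K" and x: "x \<in> X" for k x
  proof (cases "D k x * l k = 0")
    case True
    moreover have "q x \<ge> 0"
      using q[OF x] l D x by (auto intro!: sum_nonneg)
    ultimately show ?thesis
      using D[OF k x] \<open>ln b > 0\<close> by (cases "D k x = 0") (auto simp: mult_nonneg_nonpos)
  next
    case False
    then have pos: "D k x > 0" "l k > 0"
      using D[OF k x] l[OF k] by (auto simp: less_le)
    have "l k * D k x \<le> q x"
      unfolding q[OF x] using k l D x assms(1) by (intro member_le_sum) auto
    then have "q x > 0"
      using pos by (smt (verit) mult_pos_pos)
    have "ln (q x) - ln (l k) \<le> q x / l k - 1"
      using ln_le_minus_one[of "q x / l k"] \<open>q x > 0\<close> pos by (simp add: ln_div)
    then have "l k * (ln (q x) - ln (l k)) \<le> q x - l k"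
      using pos by (simp add: field_simps)
    then have "l k * log b (q x) + (l k - q x) / ln b \<le> l k * log b (l k)"
      using \<open>ln b > 0\<close> divide_right_mono[of _ "q x - l k" "ln b"]
      by (fastforce simp: log_def right_diff_distrib diff_divide_distrib)
    then show ?thesis
      using pos by simp
  qed
  have "(\<Sum>k\<in>K. l k * log b (l k)) = (\<Sum>k\<in>K. \<Sum>x\<in>X. D k x * (l k * log b (l k)))"
    by (simp add: rows flip: sum_distrib_right)
  also have "\<dots> \<ge> (\<Sum>k\<in>K. \<Sum>x\<in>X. D k x * (l k * log b (q x) + (l k - q x) / ln b))"
    by (intro sum_mono pointwise)
  also have "(\<Sum>k\<in>K. \<Sum>x\<in>X. D k x * (l k * log b (q x) + (l k - q x) / ln b))
      = (\<Sum>k\<in>K. \<Sum>x\<in>X. l k * D k x * log b (q x)) + ((\<Sum>k\<in>K. \<Sum>x\<in>X. D k x * l k) - (\<Sum>k\<in>K. \<Sum>x\<in>X. D k x * q x)) / ln b"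
    by (simp add: ring_distribs sum.distrib sum_subtractf sum_divide_distrib diff_divide_distrib mult_ac)
  also have "(\<Sum>k\<in>K. \<Sum>x\<in>X. l k * D k x * log b (q x)) = (\<Sum>x\<in>X. q x * log b (q x))"
    by (subst sum.swap) (simp add: q sum_distrib_right)
  also have "(\<Sum>k\<in>K. \<Sum>x\<in>X. D k x * l k) = (\<Sum>x\<in>X. q x)"
    by (subst sum.swap) (simp add: q mult.commute)
  also have "(\<Sum>k\<in>K. \<Sum>x\<in>X. D k x * q x) = (\<Sum>x\<in>X. q x)"
    by (subst sum.swap) (simp add: cols flip: sum_distrib_right)
  finally show ?thesis
    by simp
qed

section \<open>Basis configurations\<close>

text \<open>Configurations are 0 outside their registers, as for \<open>enc\<close>, so those of
  disjoint register sets combine by pointwise addition.\<close>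

definition configs :: "nat \<Rightarrow> nat set \<Rightarrow> (nat \<Rightarrow> nat) set" where
  "configs d X = {c. (\<forall>p\<in>X. c p < d) \<and> (\<forall>p. p \<notin> X \<longrightarrow> c p = 0)}"

text \<open>Registers are inserted in increasing order: the new largest one carries the most
  significant digit, and the remaining ones encode \<open>k mod d ^ card A\<close>.\<close>

lemma bij_betw_enc:
  assumes "finite X" "d > 0"
  shows "bij_betw (enc d X) {..<d ^ card X} (configs d X)"
  using assms(1)
proof (induction X rule: finite_linorder_max_induct)
  case empty
  then show ?case
    by (auto simp: bij_betw_def configs_def enc_def inj_on_def)
next
  case (insert b A)
  let ?D = "d ^ card A"
  have "b \<notin> A"
    using insert by auto
  have enc_insert: "enc d (insert b A) k = (enc d A (k mod ?D))(b := k div ?D mod d)" for k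
  proof
    fix p
    consider "p = b" | "p \<in> A" | "p \<noteq> b" "p \<notin> A"
      by blast
    then show "enc d (insert b A) k p = ((enc d A (k mod ?D))(b := k div ?D mod d)) p"
    proof cases
      case 1
      then have "{q \<in> insert b A. q < p} = A"
        using insert by auto
      then show ?thesis
        using 1 by (simp add: enc_def)
    next
      case 2
      then have eq: "{q \<in> insert b A. q < p} = {q \<in> A. q < p}"
        using insert by force
      \<comment> \<open>The rank of \<open>p\<close> lies strictly below \<open>card A\<close>, so
        reducing \<open>k\<close> modulo \<open>d ^ card A\<close> leaves this digit
        unchanged.\<close>
      have "card {q \<in> A. q < p} < card A"
        using 2 insert by (intro psubset_card_mono) auto
      then obtain j where "card A = card {q \<in> A. q < p} + Suc j"
        using less_imp_Suc_add by fastforce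
      then have "?D = d ^ card {q \<in> A. q < p} * (d * d ^ j)"
        by (simp add: power_add)
      then have "k mod ?D div d ^ card {q \<in> A. q < p} = k div d ^ card {q \<in> A. q < p} mod (d * d ^ j)"
        using \<open>d > 0\<close> by (simp only: mod_mult2_eq) simp
      then have "k mod ?D div d ^ card {q \<in> A. q < p} mod d = k div d ^ card {q \<in> A. q < p} mod d"
        by (simp add: mod_mod_cancel)
      moreover have "p \<noteq> b"
        using 2 \<open>b \<notin> A\<close> by blast
      ultimately show ?thesis
        using 2 eq by (simp add: enc_def)
    qed (simp add: enc_def)
  qed
  have card: "card (insert b A) = Suc (card A)"
    using insert \<open>b \<notin> A\<close> by simp
  have D: "?D > 0"
    using \<open>d > 0\<close> by simp
  have enc0: "enc d A k b = 0" for k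
    using \<open>b \<notin> A\<close> by (simp add: enc_def)
  have inj: "k = l" if k: "k < d ^ card (insert b A)" "l < d ^ card (insert b A)"
    and eq: "enc d (insert b A) k = enc d (insert b A) l" for k l
  proof -
    have less: "k div ?D < d" "l div ?D < d"
      using k by (auto simp: card less_mult_imp_div_less mult.commute)
    have "k div ?D = l div ?D"
      using fun_cong[OF eq, of b] less by (simp add: enc_insert)
    moreover have "enc d A (k mod ?D) = enc d A (l mod ?D)"
      using arg_cong[OF eq, of "\<lambda>c. c(b := 0)"] by (simp add: enc_insert enc0 fun_upd_idem)
    then have "k mod ?D = l mod ?D"
      using insert.IH D by (auto simp: bij_betw_def dest!: inj_onD)
    ultimately show ?thesis
      by (metis div_mult_mod_eq)
  qed
  have "enc d (insert b A) k \<in> configs d (insert b A)" for k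
    using \<open>d > 0\<close> by (auto simp: configs_def enc_def)
  moreover have "c \<in> enc d (insert b A) ` {..<d ^ card (insert b A)}" if c: "c \<in> configs d (insert b A)" for c
  proof -
    have "c(b := 0) \<in> configs d A"
      using c \<open>b \<notin> A\<close> by (auto simp: configs_def)
    then obtain k where k: "k < ?D" "enc d A k = c(b := 0)"
      unfolding bij_betw_imp_surj_on[OF insert.IH, symmetric] by auto
    have "c b < d"
      using c by (auto simp: configs_def)
    have "c b * ?D + k < Suc (c b) * ?D"
      using k by simp
    also have "\<dots> \<le> d * ?D"
      using \<open>c b < d\<close> by (intro mult_right_mono) auto
    finally have "c b * ?D + k < d ^ card (insert b A)"
      by (simp add: card)
    moreover have "enc d (insert b A) (c b * ?D + k) = c"
      using k \<open>c b < d\<close> by (auto simp: enc_insert)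
    ultimately show ?thesis
      by (metis imageI lessThan_iff)
  qed
  ultimately show ?case
    using inj by (auto simp: bij_betw_def inj_on_def)
qed

lemma finite_configs [simp]: "finite X \<Longrightarrow> d > 0 \<Longrightarrow> finite (configs d X)"
  using bij_betw_finite[OF bij_betw_enc] by simp

lemma configs_empty [simp]: "configs d {} = {\<lambda>_. 0}"
  by (auto simp: configs_def)

lemma sum_configs_Un:
  assumes "A \<inter> B = {}"
  shows "sum f (configs d (A \<union> B)) = (\<Sum>a\<in>configs d A. \<Sum>b\<in>configs d B. f (\<lambda>p. a p + b p))"
  unfolding sum.cartesian_product
  using disjoint_iff[THEN iffD1, OF assms] disjoint_iff[THEN iffD1, OF assms[unfolded Int_commute[of A]]]
  by (intro sum.reindex_bij_witness[where i="\<lambda>(a, b) p. a p + b p"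
        and j="\<lambda>c. (\<lambda>p. if p \<in> A then c p else 0, \<lambda>p. if p \<in> B then c p else 0)"])
    (auto simp: configs_def fun_eq_iff intro!: arg_cong[where f=f])

lemma sum_configs_singleton:
  "sum f (configs d {p}) = (\<Sum>x<d. f (\<lambda>q. if q = p then x else 0))"
  by (intro sum.reindex_bij_witness[where i="\<lambda>x q. if q = p then x else 0" and j="\<lambda>c. c p"])
    (auto simp: configs_def fun_eq_iff intro!: arg_cong[where f=f])

text \<open>Transfer from matrix indices to configurations. Every entropy below is obtained from it
  by exhibiting scaled eigenvectors \<open>w y\<close> with squared norms
  \<open>p y\<close>.\<close>

lemma ent_gram:
  fixes p :: "'b \<Rightarrow> real"
  assumes "d > 0" "finite J" "X \<subseteq> {0..<N}"
    and gram: "\<And>a c. a \<in> configs d X \<Longrightarrow> c \<in> configs d X \<Longrightarrow>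
      (\<Sum>k\<in>configs d ({0..<N} - X). psi (\<lambda>p. a p + k p) * cnj (psi (\<lambda>p. c p + k p))) = (\<Sum>y\<in>J. w y a * cnj (w y c))"
    and orth: "\<And>x y. x \<in> J \<Longrightarrow> y \<in> J \<Longrightarrow>
      (\<Sum>a\<in>configs d X. cnj (w x a) * w y a) = (if x = y then of_real (p x) else 0)"
  shows "ent d N psi X = - (\<Sum>y\<in>J. p y * log d (p y))"
  unfolding ent_def
proof (rule vn_entropy_gram[where w="\<lambda>y i. w y (enc d X i)"])
  have fin: "finite X" "finite ({0..<N} - X)"
    using \<open>X \<subseteq> {0..<N}\<close> finite_subset by auto
  note bij = bij_betw_enc[OF fin(1) \<open>d > 0\<close>] and bij' = bij_betw_enc[OF fin(2) \<open>d > 0\<close>]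
  show "reduced d N psi X \<in> carrier_mat (d ^ card X) (d ^ card X)"
    by (simp add: reduced_def Let_def)
  show "reduced d N psi X $$ (i, j) = (\<Sum>y\<in>J. w y (enc d X i) * cnj (w y (enc d X j)))"
    if "i < d ^ card X" "j < d ^ card X" for i j
  proof -
    have "reduced d N psi X $$ (i, j) = (\<Sum>k\<in>configs d ({0..<N} - X).
        psi (\<lambda>p. enc d X i p + k p) * cnj (psi (\<lambda>p. enc d X j p + k p)))"
      using that sum.reindex_bij_betw[OF bij', of "\<lambda>k. psi (\<lambda>p. enc d X i p + k p) * cnj (psi (\<lambda>p. enc d X j p + k p))"]
      by (simp add: reduced_def Let_def)
    also have "\<dots> = (\<Sum>y\<in>J. w y (enc d X i) * cnj (w y (enc d X j)))"
      using that bij by (intro gram) (auto simp: bij_betw_def)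
    finally show ?thesis .
  qed
  show "(\<Sum>i<d ^ card X. cnj (w x (enc d X i)) * w y (enc d X i)) = (if x = y then of_real (p x) else 0)"
    if "x \<in> J" "y \<in> J" for x y
    using sum.reindex_bij_betw[OF bij, of "\<lambda>a. cnj (w x a) * w y a"] orth[OF that] by simp
qed (fact \<open>finite J\<close>)

section \<open>The last two measurements\<close>

lemma sum_delta_mult_cnj:
  fixes f g :: "'b \<Rightarrow> complex"
  assumes "finite S"
  shows "(\<Sum>y\<in>S. (if a = y then f y else 0) * cnj (if c = y then g y else 0))
    = (if a = c \<and> a \<in> S then f a * cnj (g a) else 0)"
proof -
  have "(\<Sum>y\<in>S. (if a = y then f y else 0) * cnj (if c = y then g y else 0))
    = (\<Sum>y\<in>S. if y = a then if a = c then f a * cnj (g a) else 0 else 0)"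
    by (intro sum.cong) auto
  then show ?thesis
    using assms by (simp only: sum.delta) auto
qed

lemma sum_delta_cnj_mult:
  assumes "finite S"
  shows "(\<Sum>z\<in>S. cnj (if z = x then u else 0) * (if z = y then v else 0))
    = (if x = y \<and> x \<in> S then cnj u * v else 0)"
proof -
  have "(\<Sum>z\<in>S. cnj (if z = x then u else 0) * (if z = y then v else 0))
    = (\<Sum>z\<in>S. if z = x then if x = y then cnj u * v else 0 else 0)"
    by (intro sum.cong) auto
  then show ?thesis
    using assms by (simp only: sum.delta) auto
qed

lemma sum_if_const: "(\<Sum>x\<in>S. if Q then f x else 0) = (if Q then sum f S else 0)"
  by simp

lemma complex_sqrt_mult_self: "x \<ge> 0 \<Longrightarrow> complex_of_real (sqrt x) * complex_of_real (sqrt x) = of_real x"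
  by (simp flip: of_real_mult)

lemma xlogx_mult:
  fixes x y :: real
  assumes "x \<ge> 0" "y \<ge> 0"
  shows "x * y * log b (x * y) = y * (x * log b x) + x * (y * log b y)"
  using assms by (cases "x = 0 \<or> y = 0") (auto simp: log_mult algebra_simps)

text \<open>Only the last measurement matters: \<open>\<phi>\<close> is the amplitude of the outcomes \<open>x\<^sub>1, \<dots>, x\<^sub>n\<^sub>-\<^sub>1\<close>,
  \<open>U\<close> is \<open>U\<^sup>(\<^sup>n\<^sup>)\<close>, and \<open>\<beta> x\<close> lists the components of the last basis vector labelled \<open>x\<close>.\<close>

locale last_measurement =
  fixes d n :: nat and \<phi> :: "(nat \<Rightarrow> nat) \<Rightarrow> complex" and U \<beta> :: "nat \<Rightarrow> nat \<Rightarrow> complex"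
  assumes d: "d \<ge> 2" and n: "n \<ge> 2"
    and \<phi>_local: "(\<And>i. i \<in> {1..n - 1} \<Longrightarrow> c i = c' i) \<Longrightarrow> \<phi> c = \<phi> c'"
    and U_rows: "x < d \<Longrightarrow> y < d \<Longrightarrow> (\<Sum>z<d. U x z * cnj (U y z)) = (if x = y then 1 else 0)"
    and \<beta>_orth: "x < d \<Longrightarrow> y < d \<Longrightarrow> (\<Sum>q<d. cnj (\<beta> x q) * \<beta> y q) = (if x = y then 1 else 0)"
begin

text \<open>Amplitude of the whole record of outcomes. The component of \<open>Q\<close> is kept
  apart so that it can be traced out.\<close>

definition h :: "(nat \<Rightarrow> nat) \<Rightarrow> complex" where
  "h c = \<phi> c * U (c (n - 1)) (c n)"

definition \<psi>\<^sub>u :: "(nat \<Rightarrow> nat) \<Rightarrow> complex" where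
  "\<psi>\<^sub>u c = (if \<forall>i\<in>{1..n}. c (n + i) = 0 then h c * \<beta> (c n) (c 0) else 0)"

definition \<psi>\<^sub>a :: "(nat \<Rightarrow> nat) \<Rightarrow> complex" where
  "\<psi>\<^sub>a c = (if \<forall>i\<in>{1..n}. c (n + i) = c i then h c * \<beta> (c n) (c 0) else 0)"

lemma d_pos [simp]: "d > 0"
  using d by simp

lemma h_local: "(\<And>i. i \<in> {1..n} \<Longrightarrow> c i = c' i) \<Longrightarrow> h c = h c'"
proof -
  assume eq: "\<And>i. i \<in> {1..n} \<Longrightarrow> c i = c' i"
  have "\<phi> c = \<phi> c'"
    by (rule \<phi>_local) (auto intro: eq)
  moreover have "c (n - 1) = c' (n - 1)" "c n = c' n"
    using n by (auto intro: eq)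
  ultimately show ?thesis
    by (simp only: h_def)
qed

lemma U_row_norm: "x < d \<Longrightarrow> (\<Sum>z<d. (cmod (U x z))\<^sup>2) = 1"
proof -
  assume "x < d"
  then have "complex_of_real (\<Sum>z<d. (cmod (U x z))\<^sup>2) = of_real 1"
    using U_rows[of x x] by (simp add: complex_norm_square del: of_real_power)
  then show ?thesis
    unfolding of_real_eq_iff .
qed

lemma \<beta>_orth': "x < d \<Longrightarrow> y < d \<Longrightarrow> (\<Sum>q<d. \<beta> x q * cnj (\<beta> y q)) = (if x = y then 1 else 0)"
  using \<beta>_orth[of y x] by (simp add: mult.commute)

section \<open>Entropies of the ancillae before amplification\<close>

text \<open>Tracing out \<open>Q\<close> contracts the last basis vectors, whose orthogonality
  forces equal outcomes \<open>x_n\<close> on both sides. If \<open>n\<close> is not in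
  \<open>X\<close>, both sides share \<open>r n\<close> and the test \<open>a n = c n\<close> reads
  \<open>0 = 0\<close>.\<close>

lemma \<rho>_unamplified:
  assumes X: "X \<subseteq> {1..n}" and a: "a \<in> configs d X" and c: "c \<in> configs d X"
  shows "(\<Sum>k\<in>configs d ({0..<2*n+1} - X). \<psi>\<^sub>u (\<lambda>p. a p + k p) * cnj (\<psi>\<^sub>u (\<lambda>p. c p + k p)))
    = (\<Sum>r\<in>configs d ({1..n} - X). if a n = c n then h (\<lambda>p. a p + r p) * cnj (h (\<lambda>p. c p + r p)) else 0)"
proof -
  let ?D = "{n+1..2*n}"
  have rest: "{0..<2*n+1} - X = ({1..n} - X) \<union> ({0} \<union> ?D)"
    using X n by auto
  have "(\<Sum>k\<in>configs d ({0..<2*n+1} - X). \<psi>\<^sub>u (\<lambda>p. a p + k p) * cnj (\<psi>\<^sub>u (\<lambda>p. c p + k p)))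
    = (\<Sum>r\<in>configs d ({1..n} - X). \<Sum>x<d. \<Sum>e\<in>configs d ?D.
        \<psi>\<^sub>u (\<lambda>p. a p + (r p + ((if p = 0 then x else 0) + e p)))
        * cnj (\<psi>\<^sub>u (\<lambda>p. c p + (r p + ((if p = 0 then x else 0) + e p)))))"
    unfolding rest by (subst sum_configs_Un, force, subst sum_configs_Un, force) (simp add: sum_configs_singleton)
  also have "\<dots> = (\<Sum>r\<in>configs d ({1..n} - X). if a n = c n then h (\<lambda>p. a p + r p) * cnj (h (\<lambda>p. c p + r p)) else 0)"
  proof (rule sum.cong[OF refl])
    fix r assume r: "r \<in> configs d ({1..n} - X)"
    have zero: "a p = 0" "c p = 0" "r p = 0" if "p = 0 \<or> p > n" for p
      using that X a c r by (auto simp: configs_def)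
    have "a n + r n < d" "c n + r n < d"
      using a c r n by (cases "n \<in> X"; auto simp: configs_def)+
    \<comment> \<open>Before amplification all detectors are in state 0, so only the zero
      configuration of them contributes.\<close>
    have "(\<Sum>e\<in>configs d ?D. \<psi>\<^sub>u (\<lambda>p. a p + (r p + ((if p = 0 then x else 0) + e p)))
        * cnj (\<psi>\<^sub>u (\<lambda>p. c p + (r p + ((if p = 0 then x else 0) + e p)))))
      = (\<Sum>e\<in>{\<lambda>_. 0}. \<psi>\<^sub>u (\<lambda>p. a p + (r p + ((if p = 0 then x else 0) + e p)))
        * cnj (\<psi>\<^sub>u (\<lambda>p. c p + (r p + ((if p = 0 then x else 0) + e p)))))" for x
    proof (rule sum.mono_neutral_right)
      show "\<forall>e\<in>configs d ?D - {\<lambda>_. 0}. \<psi>\<^sub>u (\<lambda>p. a p + (r p + ((if p = 0 then x else 0) + e p)))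
        * cnj (\<psi>\<^sub>u (\<lambda>p. c p + (r p + ((if p = 0 then x else 0) + e p)))) = 0"
      proof
        fix e assume e: "e \<in> configs d ?D - {\<lambda>_. 0}"
        then obtain p where "e p \<noteq> 0"
          by auto
        then have "p \<in> ?D"
          using e by (auto simp: configs_def)
        then have "p - n \<in> {1..n}" "n + (p - n) = p"
          by auto
        with \<open>e p \<noteq> 0\<close> have "\<psi>\<^sub>u (\<lambda>p. a p + (r p + ((if p = 0 then x else 0) + e p))) = 0"
          unfolding \<psi>\<^sub>u_def by (intro if_not_P notI) (drule (1) bspec, simp)
        then show "\<psi>\<^sub>u (\<lambda>p. a p + (r p + ((if p = 0 then x else 0) + e p)))
        * cnj (\<psi>\<^sub>u (\<lambda>p. c p + (r p + ((if p = 0 then x else 0) + e p)))) = 0"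
          by simp
      qed
    qed (simp, simp add: configs_def)
    moreover have "\<psi>\<^sub>u (\<lambda>p. f p + (r p + (if p = 0 then x else 0))) = h (\<lambda>p. f p + r p) * \<beta> (f n + r n) x"
      if "\<And>p. p = 0 \<or> p > n \<Longrightarrow> f p = 0" for f x
    proof -
      have "h (\<lambda>p. f p + (r p + (if p = 0 then x else 0))) = h (\<lambda>p. f p + r p)"
        by (rule h_local) auto
      then show ?thesis
        using that zero n by (simp add: \<psi>\<^sub>u_def)
    qed
    ultimately have "(\<Sum>x<d. \<Sum>e\<in>configs d ?D. \<psi>\<^sub>u (\<lambda>p. a p + (r p + ((if p = 0 then x else 0) + e p)))
        * cnj (\<psi>\<^sub>u (\<lambda>p. c p + (r p + ((if p = 0 then x else 0) + e p)))))
      = h (\<lambda>p. a p + r p) * cnj (h (\<lambda>p. c p + r p)) * (\<Sum>x<d. \<beta> (a n + r n) x * cnj (\<beta> (c n + r n) x))"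
      using zero by (simp add: sum_distrib_left ac_simps)
    also have "\<dots> = (if a n = c n then h (\<lambda>p. a p + r p) * cnj (h (\<lambda>p. c p + r p)) else 0)"
      using \<beta>_orth'[OF \<open>a n + r n < d\<close> \<open>c n + r n < d\<close>] by simp
    finally show "(\<Sum>x<d. \<Sum>e\<in>configs d ?D. \<psi>\<^sub>u (\<lambda>p. a p + (r p + ((if p = 0 then x else 0) + e p)))
        * cnj (\<psi>\<^sub>u (\<lambda>p. c p + (r p + ((if p = 0 then x else 0) + e p)))))
      = (if a n = c n then h (\<lambda>p. a p + r p) * cnj (h (\<lambda>p. c p + r p)) else 0)" .
  qed
  finally show ?thesis .
qed

text \<open>\<open>p_last\<close> and \<open>p_prev\<close> are the outcome distributions of \<open>A\<^sub>n\<close> and \<open>A\<^sub>n\<^sub>-\<^sub>1\<close>.\<close>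

definition p_last :: "nat \<Rightarrow> real" where
  "p_last y = (\<Sum>r\<in>configs d {1..n - 1}. (cmod (h (r(n := y))))\<^sup>2)"

definition p_prev :: "nat \<Rightarrow> real" where
  "p_prev y = (\<Sum>r\<in>configs d {1..n - 1}. if r (n - 1) = y then (cmod (\<phi> r))\<^sup>2 else 0)"

lemma h_upd: "r (n - 1) = x \<Longrightarrow> h (r(n := y)) = \<phi> r * U x y"
proof -
  assume "r (n - 1) = x"
  moreover have "\<phi> (r(n := y)) = \<phi> r"
    using n by (intro \<phi>_local) auto
  moreover have "n - 1 \<noteq> n"
    using n by auto
  ultimately show ?thesis
    by (simp add: h_def)
qed

lemma p_last_nonneg: "p_last y \<ge> 0"
  by (simp add: p_last_def sum_nonneg)

text \<open>The state of this single ancilla is already diagonal, so the eigenvectors are scaled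
  basis vectors.\<close>

lemma ent_last: "ent d (2*n+1) \<psi>\<^sub>u {n} = - (\<Sum>y<d. p_last y * log d (p_last y))"
proof (rule ent_gram[where w="\<lambda>y a. if a n = y then of_real (sqrt (p_last y)) else 0"])
  show "{n} \<subseteq> {0..<2*n+1}"
    by auto
  fix a c assume ac: "a \<in> configs d {n}" "c \<in> configs d {n}"
  have X: "{n} \<subseteq> {1..n}"
    using n by auto
  have rest: "{1..n} - {n} = {1..n-1}"
    using n by auto
  have a_n: "a n < d"
    using ac by (auto simp: configs_def)
  have "(\<Sum>r\<in>configs d {1..n-1}. h (\<lambda>p. a p + r p) * cnj (h (\<lambda>p. c p + r p))) = of_real (p_last (a n))"
    if "a n = c n"
  proof -
    have "c = a"
      using ac that by (auto simp: configs_def fun_eq_iff) (metis)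
    have "h (\<lambda>p. a p + r p) = h (r(n := a n))" if "r \<in> configs d {1..n-1}" for r
      using that ac n by (intro h_local) (auto simp: configs_def)
    then show ?thesis
      unfolding p_last_def \<open>c = a\<close> by (simp add: complex_norm_square del: of_real_power)
  qed
  then show "(\<Sum>k\<in>configs d ({0..<2*n+1} - {n}). \<psi>\<^sub>u (\<lambda>p. a p + k p) * cnj (\<psi>\<^sub>u (\<lambda>p. c p + k p)))
    = (\<Sum>y<d. (if a n = y then of_real (sqrt (p_last y)) else 0) * cnj (if c n = y then of_real (sqrt (p_last y)) else 0))"
    unfolding \<rho>_unamplified[OF X ac] rest
    using a_n p_last_nonneg by (auto simp: sum_delta_mult_cnj complex_sqrt_mult_self)
next
  fix x y assume "x \<in> {..<d}" "y \<in> {..<d}"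
  then show "(\<Sum>a\<in>configs d {n}. cnj (if a n = x then of_real (sqrt (p_last x)) else 0) * (if a n = y then of_real (sqrt (p_last y)) else 0))
    = (if x = y then of_real (p_last x) else 0)"
    using p_last_nonneg by (auto simp: sum_configs_singleton sum_delta_cnj_mult complex_sqrt_mult_self)
qed auto

text \<open>Only \<open>Q\<close> and the idle detectors are traced out, so each value
  \<open>y\<close> of the last outcome leaves one vector: \<open>h\<close> cut down to the
  configurations with \<open>a n = y\<close>.\<close>

lemma ent_all: "ent d (2*n+1) \<psi>\<^sub>u {1..n} = - (\<Sum>y<d. p_last y * log d (p_last y))"
proof (rule ent_gram[where w="\<lambda>y a. if a n = y then h a else 0"])
  fix a c assume ac: "a \<in> configs d {1..n}" "c \<in> configs d {1..n}"
  have "a n < d"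
    using ac n by (auto simp: configs_def)
  then show "(\<Sum>k\<in>configs d ({0..<2*n+1} - {1..n}). \<psi>\<^sub>u (\<lambda>p. a p + k p) * cnj (\<psi>\<^sub>u (\<lambda>p. c p + k p)))
    = (\<Sum>y<d. (if a n = y then h a else 0) * cnj (if c n = y then h c else 0))"
    unfolding \<rho>_unamplified[OF order_refl ac]
    by (auto simp: sum_delta_mult_cnj)
next
  fix x y assume xy: "x \<in> {..<d}" "y \<in> {..<d}"
  have split: "{1..n} = {1..n-1} \<union> {n}"
    using n by auto
  have "(\<Sum>a\<in>configs d {1..n}. cnj (if a n = x then h a else 0) * (if a n = x then h a else 0))
    = (\<Sum>r\<in>configs d {1..n-1}. \<Sum>z<d. if z = x then of_real ((cmod (h (r(n := x))))\<^sup>2) else 0)"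
  proof -
    have "(\<Sum>a\<in>configs d {1..n}. cnj (if a n = x then h a else 0) * (if a n = x then h a else 0))
      = (\<Sum>r\<in>configs d {1..n-1}. \<Sum>z<d. cnj (if r n + z = x then h (\<lambda>p. r p + (if p = n then z else 0)) else 0)
          * (if r n + z = x then h (\<lambda>p. r p + (if p = n then z else 0)) else 0))"
      unfolding split using n by (subst sum_configs_Un) (auto simp: sum_configs_singleton)
    also have "\<dots> = (\<Sum>r\<in>configs d {1..n-1}. \<Sum>z<d. if z = x then of_real ((cmod (h (r(n := x))))\<^sup>2) else 0)"
    proof (intro sum.cong refl)
      fix r z assume "r \<in> configs d {1..n-1}"
      then have "r n = 0"
        using n by (auto simp: configs_def)
      then have "h (\<lambda>p. r p + (if p = n then z else 0)) = h (r(n := z))"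
        by (intro h_local) auto
      then show "cnj (if r n + z = x then h (\<lambda>p. r p + (if p = n then z else 0)) else 0)
          * (if r n + z = x then h (\<lambda>p. r p + (if p = n then z else 0)) else 0)
        = (if z = x then of_real ((cmod (h (r(n := x))))\<^sup>2) else 0)"
        using \<open>r n = 0\<close> by (simp add: complex_norm_square mult.commute del: of_real_power)
    qed
    finally show ?thesis .
  qed
  also have "\<dots> = of_real (p_last x)"
    using xy by (simp add: p_last_def)
  finally show "(\<Sum>a\<in>configs d {1..n}. cnj (if a n = x then h a else 0) * (if a n = y then h a else 0))
    = (if x = y then of_real (p_last x) else 0)"
    by (cases "x = y") (auto intro!: sum.neutral)
qed auto

text \<open>Summing over the outcome of the traced-out last ancilla pairs two rows of
  \<open>U\<close>; their orthonormality leaves one pure state per value of the previous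
  outcome.\<close>

lemma ent_prev: "ent d (2*n+1) \<psi>\<^sub>u {1..n-1} = - (\<Sum>y<d. p_prev y * log d (p_prev y))"
proof (rule ent_gram[where w="\<lambda>y a. if a (n-1) = y then \<phi> a else 0"])
  show "{1..n-1} \<subseteq> {0..<2*n+1}"
    by auto
  fix a c assume ac: "a \<in> configs d {1..n-1}" "c \<in> configs d {1..n-1}"
  have X: "{1..n-1} \<subseteq> {1..n}"
    by auto
  have rest: "{1..n} - {1..n-1} = {n}"
    using n by auto
  have zero: "a n = 0" "c n = 0"
    using ac n by (auto simp: configs_def)
  have less: "a (n-1) < d" "c (n-1) < d"
    using ac n by (auto simp: configs_def)
  have h_eq: "h (\<lambda>p. f p + (if p = n then x else 0)) = \<phi> f * U (f (n-1)) x" if "f n = 0" for f x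
  proof -
    have "h (\<lambda>p. f p + (if p = n then x else 0)) = h (f(n := x))"
      using that by (intro h_local) auto
    then show ?thesis
      by (simp add: h_upd)
  qed
  have "(\<Sum>k\<in>configs d ({0..<2*n+1} - {1..n-1}). \<psi>\<^sub>u (\<lambda>p. a p + k p) * cnj (\<psi>\<^sub>u (\<lambda>p. c p + k p)))
    = \<phi> a * cnj (\<phi> c) * (\<Sum>x<d. U (a (n-1)) x * cnj (U (c (n-1)) x))"
    unfolding \<rho>_unamplified[OF X ac] rest using zero
    by (simp add: sum_configs_singleton h_eq sum_distrib_left ac_simps)
  also have "\<dots> = (\<Sum>y<d. (if a (n-1) = y then \<phi> a else 0) * cnj (if c (n-1) = y then \<phi> c else 0))"
    using less by (auto simp: U_rows sum_delta_mult_cnj)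
  finally show "(\<Sum>k\<in>configs d ({0..<2*n+1} - {1..n-1}). \<psi>\<^sub>u (\<lambda>p. a p + k p) * cnj (\<psi>\<^sub>u (\<lambda>p. c p + k p)))
    = (\<Sum>y<d. (if a (n-1) = y then \<phi> a else 0) * cnj (if c (n-1) = y then \<phi> c else 0))" .
next
  fix x y assume "x \<in> {..<d}" "y \<in> {..<d}"
  have "(\<Sum>a\<in>configs d {1..n-1}. cnj (if a (n-1) = x then \<phi> a else 0) * (if a (n-1) = x then \<phi> a else 0))
    = of_real (p_prev x)"
    unfolding p_prev_def of_real_sum
    by (intro sum.cong refl) (simp add: complex_norm_square mult.commute del: of_real_power)
  then show "(\<Sum>a\<in>configs d {1..n-1}. cnj (if a (n-1) = x then \<phi> a else 0) * (if a (n-1) = y then \<phi> a else 0))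
    = (if x = y then of_real (p_prev x) else 0)"
    by (cases "x = y") (auto intro!: sum.neutral)
qed auto

section \<open>The joint state of the last two ancillae\<close>

text \<open>Isolates the outcome \<open>x\<close> of the previous ancilla from the earlier ones. For
  \<open>n = 2\<close> there are no earlier ones, and \<open>r\<close> ranges over the zero
  configuration alone.\<close>

lemma p_last_split:
  "p_last y = (\<Sum>x<d. \<Sum>r\<in>configs d {1..n-2}. (cmod (\<phi> (r(n - 1 := x)) * U x y))\<^sup>2)"
proof -
  have split: "{1..n-1} = {1..n-2} \<union> {n-1}"
    using n by auto
  have "p_last y = (\<Sum>r\<in>configs d {1..n-2}. \<Sum>x<d. (cmod (h ((\<lambda>p. r p + (if p = n - 1 then x else 0))(n := y))))\<^sup>2)"
    unfolding p_last_def split using n by (subst sum_configs_Un) (auto simp: sum_configs_singleton)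
  also have "\<dots> = (\<Sum>r\<in>configs d {1..n-2}. \<Sum>x<d. (cmod (\<phi> (r(n - 1 := x)) * U x y))\<^sup>2)"
  proof (intro sum.cong refl)
    fix r x assume "r \<in> configs d {1..n-2}"
    moreover have "n - 1 \<notin> {1..n-2}"
      using n by auto
    ultimately have "r (n - 1) = 0"
      unfolding configs_def by blast
    then have "(\<lambda>p. r p + (if p = n - 1 then x else 0)) = r(n - 1 := x)"
      by auto
    then show "(cmod (h ((\<lambda>p. r p + (if p = n - 1 then x else 0))(n := y))))\<^sup>2 = (cmod (\<phi> (r(n - 1 := x)) * U x y))\<^sup>2"
      by (simp add: h_upd[where x=x])
  qed
  also have "\<dots> = (\<Sum>x<d. \<Sum>r\<in>configs d {1..n-2}. (cmod (\<phi> (r(n - 1 := x)) * U x y))\<^sup>2)"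
    by (rule sum.swap)
  finally show ?thesis .
qed

lemma p_prev_split:
  assumes "y < d"
  shows "p_prev y = (\<Sum>r\<in>configs d {1..n-2}. (cmod (\<phi> (r(n - 1 := y))))\<^sup>2)"
proof -
  have split: "{1..n-1} = {1..n-2} \<union> {n-1}"
    using n by auto
  have "p_prev y = (\<Sum>r\<in>configs d {1..n-2}. \<Sum>x<d. if r (n - 1) + x = y
      then (cmod (\<phi> (\<lambda>p. r p + (if p = n - 1 then x else 0))))\<^sup>2 else 0)"
    unfolding p_prev_def split using n by (subst sum_configs_Un) (auto simp: sum_configs_singleton simp del: One_nat_def)
  also have "\<dots> = (\<Sum>r\<in>configs d {1..n-2}. \<Sum>x<d. if x = y then (cmod (\<phi> (r(n - 1 := y))))\<^sup>2 else 0)"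
  proof (intro sum.cong refl)
    fix r x assume "r \<in> configs d {1..n-2}"
    moreover have "n - 1 \<notin> {1..n-2}"
      using n by auto
    ultimately have "r (n - 1) = 0"
      unfolding configs_def by blast
    then have "(\<lambda>p. r p + (if p = n - 1 then x else 0)) = r(n - 1 := x)"
      by auto
    then show "(if r (n - 1) + x = y then (cmod (\<phi> (\<lambda>p. r p + (if p = n - 1 then x else 0))))\<^sup>2 else 0)
      = (if x = y then (cmod (\<phi> (r(n - 1 := y))))\<^sup>2 else 0)"
      using \<open>r (n - 1) = 0\<close> by simp
  qed
  also have "\<dots> = (\<Sum>r\<in>configs d {1..n-2}. (cmod (\<phi> (r(n - 1 := y))))\<^sup>2)"
    using assms by simp
  finally show ?thesis .
qed

lemma ent_last_two_bounds:
  shows "ent d (2*n+1) \<psi>\<^sub>u ({n-1} \<union> {n}) \<ge> - (\<Sum>y<d. p_last y * log d (p_last y))"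
    and "ent d (2*n+1) \<psi>\<^sub>u ({n-1} \<union> {n})
      \<le> - (\<Sum>y<d. \<Sum>x<d. p_prev x * (cmod (U x y))\<^sup>2 * log d (p_prev x * (cmod (U x y))\<^sup>2))"
proof -
  define G where "G = (\<lambda>y r x. \<phi> (r(n - 1 := x)) * U x y)"
  let ?R = "configs d {1..n-2}"
  \<comment> \<open>Tracing out \<open>Q\<close> makes the state block diagonal in \<open>x\<^sub>n\<close>; diagonalise each block.\<close>
  define P where "P = (\<lambda>y v l. (\<forall>j<d. \<forall>k<d. (\<Sum>x<d. cnj (v j x) * v k x) = (if j = k then 1 else 0))
    \<and> (\<forall>x<d. \<forall>x'<d. (\<Sum>k<d. v k x * cnj (v k x')) = (if x = x' then 1 else 0))
    \<and> (\<forall>k<d. l k \<ge> 0)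
    \<and> (\<forall>x<d. \<forall>x'<d. (\<Sum>r\<in>?R. G y r x * cnj (G y r x')) = (\<Sum>k<d. of_real (l k) * v k x * cnj (v k x'))))"
  have "\<exists>v l. P y v l" for y
    by (rule gram_spectral_decomposition[where d=d and R="?R" and g="G y"]) (unfold P_def, blast)
  then obtain V L where VL: "\<And>y. P y (V y) (L y)"
    by metis
  have orth: "\<And>y j k. j < d \<Longrightarrow> k < d \<Longrightarrow> (\<Sum>x<d. cnj (V y j x) * V y k x) = (if j = k then 1 else 0)"
    and complete: "\<And>y x x'. x < d \<Longrightarrow> x' < d \<Longrightarrow> (\<Sum>k<d. V y k x * cnj (V y k x')) = (if x = x' then 1 else 0)"
    and nonneg: "\<And>y k. k < d \<Longrightarrow> L y k \<ge> 0"
    and decomp: "\<And>y x x'. x < d \<Longrightarrow> x' < d \<Longrightarrow>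
      (\<Sum>r\<in>?R. G y r x * cnj (G y r x')) = (\<Sum>k<d. of_real (L y k) * V y k x * cnj (V y k x'))"
    using VL unfolding P_def by blast+
  \<comment> \<open>Squared moduli of a unitary matrix: orthonormality gives the row sums,
    completeness the column sums.\<close>
  define D where "D = (\<lambda>y k x. (cmod (V y k x))\<^sup>2)"
  have rows: "(\<Sum>x<d. D y k x) = 1" if "k < d" for y k
  proof -
    have "complex_of_real (\<Sum>x<d. D y k x) = of_real 1"
      using orth[OF that that, of y] by (simp add: D_def complex_norm_square mult.commute del: of_real_power)
    then show ?thesis
      unfolding of_real_eq_iff .
  qed
  have cols: "(\<Sum>k<d. D y k x) = 1" if "x < d" for y x
  proof -
    have "complex_of_real (\<Sum>k<d. D y k x) = of_real 1"
      using complete[OF that that, of y] by (simp add: D_def complex_norm_square del: of_real_power)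
    then show ?thesis
      unfolding of_real_eq_iff .
  qed
  have diag: "(\<Sum>r\<in>?R. (cmod (G y r x))\<^sup>2) = (\<Sum>k<d. L y k * D y k x)" if "x < d" for y x
  proof -
    have "complex_of_real (\<Sum>r\<in>?R. (cmod (G y r x))\<^sup>2) = of_real (\<Sum>k<d. L y k * D y k x)"
      using decomp[OF that that, of y]
      by (simp add: D_def complex_norm_square mult.assoc del: of_real_power)
    then show ?thesis
      unfolding of_real_eq_iff .
  qed
  \<comment> \<open>The diagonal of block \<open>y\<close> is the joint distribution of the last two
    outcomes; it factors because \<open>U\<close> sees the past only through
    \<open>x\<close>.\<close>
  have diag_prev: "p_prev x * (cmod (U x y))\<^sup>2 = (\<Sum>k<d. L y k * D y k x)" if "x < d" for x y
    using that
    by (simp add: p_prev_split G_def norm_mult power_mult_distrib sum_distrib_right flip: diag)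
  have trace: "p_last y = (\<Sum>k<d. L y k)" for y
  proof -
    have "p_last y = (\<Sum>x<d. \<Sum>k<d. L y k * D y k x)"
      unfolding p_last_split by (intro sum.cong refl) (simp add: G_def flip: diag)
    also have "\<dots> = (\<Sum>k<d. L y k * (\<Sum>x<d. D y k x))"
      unfolding sum_distrib_left by (rule sum.swap)
    finally show ?thesis
      by (simp add: rows)
  qed
  have pair_sum: "sum f (configs d ({n-1} \<union> {n})) = (\<Sum>x<d. \<Sum>z<d. f (\<lambda>p. (if p = n-1 then x else 0) + (if p = n then z else 0)))"
    for f :: "(nat \<Rightarrow> nat) \<Rightarrow> complex"
    using n by (subst sum_configs_Un) (auto simp: sum_configs_singleton)
  have ne: "n - 1 \<noteq> n" "n \<noteq> n - 1"
    using n by auto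
  \<comment> \<open>The \<open>k\<close>-th eigenvector of block \<open>y\<close>, scaled by the
    root of its eigenvalue and extended by 0 to the other blocks.\<close>
  define w where "w = (\<lambda>(y, k) a. if a n = y then of_real (sqrt (L y k)) * V y k (a (n - 1)) else 0)"
  have "ent d (2*n+1) \<psi>\<^sub>u ({n-1} \<union> {n})
    = - (\<Sum>yk\<in>{..<d} \<times> {..<d}. (case yk of (y, k) \<Rightarrow> L y k) * log d (case yk of (y, k) \<Rightarrow> L y k))"
  proof (rule ent_gram[where w=w])
    show "{n-1} \<union> {n} \<subseteq> {0..<2*n+1}"
      by auto
    fix a c assume ac: "a \<in> configs d ({n-1} \<union> {n})" "c \<in> configs d ({n-1} \<union> {n})"
    have X: "{n-1} \<union> {n} \<subseteq> {1..n}"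
      using n by auto
    have rest: "{1..n} - ({n-1} \<union> {n}) = {1..n-2}"
      using n by auto
    have less: "a n < d" "a (n-1) < d" "c (n-1) < d"
      using ac by (auto simp: configs_def)
    have h_eq: "h (\<lambda>p. f p + r p) = G (f n) r (f (n-1))" if "f \<in> configs d ({n-1} \<union> {n})" "r \<in> ?R" for f r
    proof -
      have "h (\<lambda>p. f p + r p) = h ((r(n - 1 := f (n - 1)))(n := f n))"
        using that n by (intro h_local) (auto simp: configs_def)
      then show ?thesis
        by (simp add: h_upd[where x="f (n - 1)"] G_def)
    qed
    have "(\<Sum>k\<in>configs d ({0..<2*n+1} - ({n-1} \<union> {n})). \<psi>\<^sub>u (\<lambda>p. a p + k p) * cnj (\<psi>\<^sub>u (\<lambda>p. c p + k p)))
      = (if a n = c n then \<Sum>r\<in>?R. G (a n) r (a (n-1)) * cnj (G (a n) r (c (n-1))) else 0)"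
      unfolding \<rho>_unamplified[OF X ac] rest using ac by (auto simp: h_eq)
    also have "\<dots> = (if a n = c n then \<Sum>k<d. of_real (L (a n) k) * V (a n) k (a (n-1)) * cnj (V (a n) k (c (n-1))) else 0)"
      using less by (simp only: decomp)
    also have "\<dots> = (\<Sum>k<d. \<Sum>y<d. w (y, k) a * cnj (w (y, k) c))"
    proof -
      have "(\<Sum>y<d. w (y, k) a * cnj (w (y, k) c))
        = (if a n = c n then of_real (L (a n) k) * V (a n) k (a (n-1)) * cnj (V (a n) k (c (n-1))) else 0)" if "k < d" for k
      proof -
        note sqrt = complex_sqrt_mult_self[OF nonneg[OF that, of "a n"]]
        show ?thesis
          unfolding w_def prod.case sum_delta_mult_cnj[OF finite_lessThan] sqrt[symmetric]
          using less by (simp add: ac_simps)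
      qed
      then show ?thesis
        by simp
    qed
    also have "\<dots> = (\<Sum>yk\<in>{..<d} \<times> {..<d}. w yk a * cnj (w yk c))"
      by (subst sum.swap) (simp add: sum.cartesian_product)
    finally show "(\<Sum>k\<in>configs d ({0..<2*n+1} - ({n-1} \<union> {n})). \<psi>\<^sub>u (\<lambda>p. a p + k p) * cnj (\<psi>\<^sub>u (\<lambda>p. c p + k p)))
      = (\<Sum>yk\<in>{..<d} \<times> {..<d}. w yk a * cnj (w yk c))" .
  next
    fix s t assume "s \<in> {..<d} \<times> {..<d}" "t \<in> {..<d} \<times> {..<d}"
    then obtain y k y' k' where st: "s = (y, k)" "t = (y', k')" and less: "y < d" "k < d" "y' < d" "k' < d"
      by auto
    have "(\<Sum>a\<in>configs d ({n-1} \<union> {n}). cnj (w s a) * w t a)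
      = (\<Sum>x<d. if y = y' then cnj (of_real (sqrt (L y k)) * V y k x) * (of_real (sqrt (L y' k')) * V y' k' x) else 0)"
    proof -
      have w_pair: "w (y, k) (\<lambda>p. (if p = n-1 then x else 0) + (if p = n then z else 0))
        = (if z = y then of_real (sqrt (L y k)) * V y k x else 0)" for y k x z
        using ne by (simp add: w_def)
      show ?thesis
        unfolding pair_sum st w_pair using less by (simp add: sum_delta_cnj_mult)
    qed
    also have "\<dots> = (if y = y' then of_real (sqrt (L y k)) * of_real (sqrt (L y k')) * (\<Sum>x<d. cnj (V y k x) * V y k' x) else 0)"
      by (simp add: sum_distrib_left ac_simps)
    also have "\<dots> = (if s = t then of_real (case s of (y, k) \<Rightarrow> L y k) else 0)"
      using less by (auto simp: st orth nonneg complex_sqrt_mult_self)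
    finally show "(\<Sum>a\<in>configs d ({n-1} \<union> {n}). cnj (w s a) * w t a)
      = (if s = t then of_real (case s of (y, k) \<Rightarrow> L y k) else 0)" .
  qed auto
  then have ent: "ent d (2*n+1) \<psi>\<^sub>u ({n-1} \<union> {n}) = - (\<Sum>y<d. \<Sum>k<d. L y k * log d (L y k))"
    by (simp add: sum.cartesian_product case_prod_beta)
  have "(\<Sum>y<d. \<Sum>k<d. L y k * log d (L y k)) \<le> (\<Sum>y<d. p_last y * log d (p_last y))"
    unfolding trace using d nonneg by (intro sum_mono sum_entropy_le_total) auto
  then show "ent d (2*n+1) \<psi>\<^sub>u ({n-1} \<union> {n}) \<ge> - (\<Sum>y<d. p_last y * log d (p_last y))"
    unfolding ent by simp
  have "(\<Sum>y<d. \<Sum>x<d. p_prev x * (cmod (U x y))\<^sup>2 * log d (p_prev x * (cmod (U x y))\<^sup>2))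
    \<le> (\<Sum>y<d. \<Sum>k<d. L y k * log d (L y k))"
  proof (rule sum_mono)
    fix y
    show "(\<Sum>x<d. p_prev x * (cmod (U x y))\<^sup>2 * log d (p_prev x * (cmod (U x y))\<^sup>2)) \<le> (\<Sum>k<d. L y k * log d (L y k))"
      using d nonneg rows cols diag_prev
      by (intro sum_entropy_doubly_stochastic[where D="D y"]) (auto simp: D_def)
  qed
  then show "ent d (2*n+1) \<psi>\<^sub>u ({n-1} \<union> {n})
      \<le> - (\<Sum>y<d. \<Sum>x<d. p_prev x * (cmod (U x y))\<^sup>2 * log d (p_prev x * (cmod (U x y))\<^sup>2))"
    unfolding ent by simp
qed

section \<open>Entropies of the detectors after amplification\<close>

text \<open>\<open>T\<close> indexes the detectors that are kept. All ancillae are traced out and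
  each kept detector copies one of them, so both \<open>a\<close> and \<open>c\<close> must display
  the same record \<open>s\<close>: the state is diagonal.\<close>

lemma \<rho>_amplified:
  assumes T: "T \<subseteq> {1..n}" and a: "a \<in> configs d ((+) n ` T)" and c: "c \<in> configs d ((+) n ` T)"
  shows "(\<Sum>k\<in>configs d ({0..<2*n+1} - (+) n ` T). \<psi>\<^sub>a (\<lambda>p. a p + k p) * cnj (\<psi>\<^sub>a (\<lambda>p. c p + k p)))
    = (\<Sum>s\<in>configs d {1..n}. if \<forall>i\<in>T. a (n + i) = s i \<and> c (n + i) = s i then of_real ((cmod (h s))\<^sup>2) else 0)"
proof -
  let ?X = "(+) n ` T" and ?E = "{n+1..2*n} - (+) n ` T"
  have rest: "{0..<2*n+1} - ?X = {1..n} \<union> ({0} \<union> ?E)"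
    using T n by auto
  have "(\<Sum>k\<in>configs d ({0..<2*n+1} - ?X). \<psi>\<^sub>a (\<lambda>p. a p + k p) * cnj (\<psi>\<^sub>a (\<lambda>p. c p + k p)))
    = (\<Sum>s\<in>configs d {1..n}. \<Sum>x<d. \<Sum>e\<in>configs d ?E.
        \<psi>\<^sub>a (\<lambda>p. a p + (s p + ((if p = 0 then x else 0) + e p)))
        * cnj (\<psi>\<^sub>a (\<lambda>p. c p + (s p + ((if p = 0 then x else 0) + e p)))))"
    unfolding rest by (subst sum_configs_Un, force, subst sum_configs_Un, force) (simp add: sum_configs_singleton)
  also have "\<dots> = (\<Sum>s\<in>configs d {1..n}. if \<forall>i\<in>T. a (n + i) = s i \<and> c (n + i) = s i then of_real ((cmod (h s))\<^sup>2) else 0)"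
  proof (rule sum.cong[OF refl])
    fix s assume s: "s \<in> configs d {1..n}"
    \<comment> \<open>The only configuration of the traced-out detectors compatible with the ancilla
      record \<open>s\<close>.\<close>
    define e\<^sub>s where "e\<^sub>s = (\<lambda>p. if p \<in> ?E then s (p - n) else 0)"
    have e\<^sub>s: "e\<^sub>s \<in> configs d ?E"
      using s by (auto simp: configs_def e\<^sub>s_def)
    have zero: "a p = 0" "c p = 0" if "p \<notin> ?X" for p
      using that a c by (auto simp: configs_def)
    have s_zero: "s p = 0" if "p = 0 \<or> p > n" for p
      using that s by (auto simp: configs_def)
    have "s n < d"
      using s n by (auto simp: configs_def)
    have val: "\<psi>\<^sub>a (\<lambda>p. f p + (s p + ((if p = 0 then x else 0) + e p)))
      = (if e = e\<^sub>s \<and> (\<forall>i\<in>T. f (n + i) = s i) then h s * \<beta> (s n) x else 0)"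
      if f: "\<And>p. p \<notin> ?X \<Longrightarrow> f p = 0" and e: "e \<in> configs d ?E" for f x e
    proof -
      have e0: "e p = 0" if "p \<notin> ?E" for p
        using that e by (auto simp: configs_def)
      have low: "f i = 0" "e i = 0" if "i \<le> n" for i
        using that T by (auto intro!: f e0)
      have "(f (n + i) + (s (n + i) + ((if n + i = 0 then x else 0) + e (n + i))) = f i + (s i + ((if i = 0 then x else 0) + e i)))
        \<longleftrightarrow> (if i \<in> T then f (n + i) else e (n + i)) = s i" if i: "i \<in> {1..n}" for i
      proof -
        have "s (n + i) = 0" "f i = 0" "e i = 0"
          using i by (auto intro!: s_zero low)
        moreover have "if i \<in> T then e (n + i) = 0 else f (n + i) = 0"
          by (auto intro!: f e0)
        ultimately show ?thesis
          using i by auto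
      qed
      then have "(\<forall>i\<in>{1..n}. f (n + i) + (s (n + i) + ((if n + i = 0 then x else 0) + e (n + i))) = f i + (s i + ((if i = 0 then x else 0) + e i)))
        \<longleftrightarrow> (\<forall>i\<in>{1..n}. (if i \<in> T then f (n + i) else e (n + i)) = s i)"
        by (simp only: ball_simps cong: ball_cong)
      also have "\<dots> \<longleftrightarrow> (\<forall>i\<in>T. f (n + i) = s i) \<and> (\<forall>i\<in>{1..n} - T. e (n + i) = s i)"
        using T by auto
      also have "(\<forall>i\<in>{1..n} - T. e (n + i) = s i) \<longleftrightarrow> e = e\<^sub>s"
      proof
        assume eq: "\<forall>i\<in>{1..n} - T. e (n + i) = s i"
        show "e = e\<^sub>s"
        proof
          fix p
          show "e p = e\<^sub>s p"
          proof (cases "p \<in> ?E")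
            case True
            then have "p - n \<in> {1..n} - T" "n + (p - n) = p"
              by (auto simp: image_iff)
            then show ?thesis
              using eq True by (force simp: e\<^sub>s_def)
          next
            case False
            then show ?thesis
              using e0[OF False] by (simp only: e\<^sub>s_def if_False)
          qed
        qed
      next
        assume "e = e\<^sub>s"
        then show "\<forall>i\<in>{1..n} - T. e (n + i) = s i"
          by (auto simp: e\<^sub>s_def)
      qed
      finally have cond: "(\<forall>i\<in>{1..n}. f (n + i) + (s (n + i) + ((if n + i = 0 then x else 0) + e (n + i))) = f i + (s i + ((if i = 0 then x else 0) + e i)))
        \<longleftrightarrow> e = e\<^sub>s \<and> (\<forall>i\<in>T. f (n + i) = s i)"
        by blast
      have "h (\<lambda>p. f p + (s p + ((if p = 0 then x else 0) + e p))) = h s"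
        by (rule h_local) (simp add: low)
      moreover have "f n + (s n + ((if n = 0 then x else 0) + e n)) = s n"
        "f 0 + (s 0 + ((if (0::nat) = 0 then x else 0) + e 0)) = x"
        using n by (simp_all add: low s_zero)
      ultimately show ?thesis
        unfolding \<psi>\<^sub>a_def cond by (simp only:)
    qed
    have "(\<Sum>e\<in>configs d ?E. \<psi>\<^sub>a (\<lambda>p. a p + (s p + ((if p = 0 then x else 0) + e p)))
        * cnj (\<psi>\<^sub>a (\<lambda>p. c p + (s p + ((if p = 0 then x else 0) + e p)))))
      = (\<Sum>e\<in>configs d ?E. if e = e\<^sub>s then if \<forall>i\<in>T. a (n + i) = s i \<and> c (n + i) = s i
          then of_real ((cmod (h s))\<^sup>2) * (\<beta> (s n) x * cnj (\<beta> (s n) x)) else 0 else 0)" for x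
    proof (intro sum.cong refl)
      fix e assume e: "e \<in> configs d ?E"
      have vals: "\<psi>\<^sub>a (\<lambda>p. a p + (s p + ((if p = 0 then x else 0) + e p)))
          = (if e = e\<^sub>s \<and> (\<forall>i\<in>T. a (n + i) = s i) then h s * \<beta> (s n) x else 0)"
        "\<psi>\<^sub>a (\<lambda>p. c p + (s p + ((if p = 0 then x else 0) + e p)))
          = (if e = e\<^sub>s \<and> (\<forall>i\<in>T. c (n + i) = s i) then h s * \<beta> (s n) x else 0)"
        by (rule val; fact zero e)+
      show "\<psi>\<^sub>a (\<lambda>p. a p + (s p + ((if p = 0 then x else 0) + e p)))
        * cnj (\<psi>\<^sub>a (\<lambda>p. c p + (s p + ((if p = 0 then x else 0) + e p))))
      = (if e = e\<^sub>s then if \<forall>i\<in>T. a (n + i) = s i \<and> c (n + i) = s i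
          then of_real ((cmod (h s))\<^sup>2) * (\<beta> (s n) x * cnj (\<beta> (s n) x)) else 0 else 0)"
        unfolding vals
        by (auto simp: complex_norm_square ac_simps simp del: of_real_power)
    qed
    then have "(\<Sum>e\<in>configs d ?E. \<psi>\<^sub>a (\<lambda>p. a p + (s p + ((if p = 0 then x else 0) + e p)))
        * cnj (\<psi>\<^sub>a (\<lambda>p. c p + (s p + ((if p = 0 then x else 0) + e p)))))
      = (if \<forall>i\<in>T. a (n + i) = s i \<and> c (n + i) = s i
          then of_real ((cmod (h s))\<^sup>2) * (\<beta> (s n) x * cnj (\<beta> (s n) x)) else 0)" for x
      using e\<^sub>s by simp
    then have "(\<Sum>x<d. \<Sum>e\<in>configs d ?E. \<psi>\<^sub>a (\<lambda>p. a p + (s p + ((if p = 0 then x else 0) + e p)))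
        * cnj (\<psi>\<^sub>a (\<lambda>p. c p + (s p + ((if p = 0 then x else 0) + e p)))))
      = (if \<forall>i\<in>T. a (n + i) = s i \<and> c (n + i) = s i
          then of_real ((cmod (h s))\<^sup>2) * (\<Sum>x<d. \<beta> (s n) x * cnj (\<beta> (s n) x)) else 0)"
      by (simp only: sum_if_const sum_distrib_left)
    then show "(\<Sum>x<d. \<Sum>e\<in>configs d ?E. \<psi>\<^sub>a (\<lambda>p. a p + (s p + ((if p = 0 then x else 0) + e p)))
        * cnj (\<psi>\<^sub>a (\<lambda>p. c p + (s p + ((if p = 0 then x else 0) + e p)))))
      = (if \<forall>i\<in>T. a (n + i) = s i \<and> c (n + i) = s i then of_real ((cmod (h s))\<^sup>2) else 0)"
      using \<beta>_orth'[OF \<open>s n < d\<close> \<open>s n < d\<close>] by simp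
  qed
  finally show ?thesis .
qed

text \<open>\<open>g\<close> is the marginal distribution of the outcomes indexed by
  \<open>T\<close>, so the entropy is the Shannon entropy of that marginal.\<close>

lemma ent_amplified:
  assumes T: "T \<subseteq> {1..n}"
  defines "g \<equiv> \<lambda>t. \<Sum>r\<in>configs d ({1..n} - T). (cmod (h (\<lambda>p. t p + r p)))\<^sup>2"
  shows "ent d (2*n+1) \<psi>\<^sub>a ((+) n ` T) = - (\<Sum>t\<in>configs d T. g t * log d (g t))"
proof (rule ent_gram[where w="\<lambda>t a. if \<forall>i\<in>T. a (n + i) = t i then of_real (sqrt (g t)) else 0"])
  have g: "g t \<ge> 0" for t
    by (simp add: g_def sum_nonneg)
  show "finite (configs d T)"
    using T by (intro finite_configs) (auto intro: finite_subset)
  show "(+) n ` T \<subseteq> {0..<2*n+1}"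
    using T by auto
  show "(\<Sum>k\<in>configs d ({0..<2*n+1} - (+) n ` T). \<psi>\<^sub>a (\<lambda>p. a p + k p) * cnj (\<psi>\<^sub>a (\<lambda>p. c p + k p)))
    = (\<Sum>t\<in>configs d T. (if \<forall>i\<in>T. a (n + i) = t i then of_real (sqrt (g t)) else 0)
        * cnj (if \<forall>i\<in>T. c (n + i) = t i then of_real (sqrt (g t)) else 0))"
    if ac: "a \<in> configs d ((+) n ` T)" "c \<in> configs d ((+) n ` T)" for a c
  proof -
    have "{1..n} = T \<union> ({1..n} - T)"
      using T by auto
    then have "(\<Sum>s\<in>configs d {1..n}. if \<forall>i\<in>T. a (n + i) = s i \<and> c (n + i) = s i then complex_of_real ((cmod (h s))\<^sup>2) else 0)
      = (\<Sum>t\<in>configs d T. \<Sum>r\<in>configs d ({1..n} - T).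
          if \<forall>i\<in>T. a (n + i) = t i + r i \<and> c (n + i) = t i + r i then of_real ((cmod (h (\<lambda>p. t p + r p)))\<^sup>2) else 0)"
      using sum_configs_Un[of T "{1..n} - T" _ d] by force
    also have "\<dots> = (\<Sum>t\<in>configs d T. \<Sum>r\<in>configs d ({1..n} - T).
          if \<forall>i\<in>T. a (n + i) = t i \<and> c (n + i) = t i then of_real ((cmod (h (\<lambda>p. t p + r p)))\<^sup>2) else 0)"
    proof (intro sum.cong refl)
      fix t r assume "r \<in> configs d ({1..n} - T)"
      then have "\<forall>i\<in>T. r i = 0"
        by (auto simp: configs_def)
      then have "(\<forall>i\<in>T. a (n + i) = t i + r i \<and> c (n + i) = t i + r i) \<longleftrightarrow> (\<forall>i\<in>T. a (n + i) = t i \<and> c (n + i) = t i)"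
        by auto
      then show "(if \<forall>i\<in>T. a (n + i) = t i + r i \<and> c (n + i) = t i + r i then complex_of_real ((cmod (h (\<lambda>p. t p + r p)))\<^sup>2) else 0)
        = (if \<forall>i\<in>T. a (n + i) = t i \<and> c (n + i) = t i then of_real ((cmod (h (\<lambda>p. t p + r p)))\<^sup>2) else 0)"
        by (simp only:)
    qed
    also have "\<dots> = (\<Sum>t\<in>configs d T. if \<forall>i\<in>T. a (n + i) = t i \<and> c (n + i) = t i then of_real (g t) else 0)"
    proof (intro sum.cong refl)
      fix t
      show "(\<Sum>r\<in>configs d ({1..n} - T). if \<forall>i\<in>T. a (n + i) = t i \<and> c (n + i) = t i
          then complex_of_real ((cmod (h (\<lambda>p. t p + r p)))\<^sup>2) else 0)
        = (if \<forall>i\<in>T. a (n + i) = t i \<and> c (n + i) = t i then of_real (g t) else 0)"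
        unfolding g_def of_real_sum by (rule sum_if_const)
    qed
    also have "\<dots> = (\<Sum>t\<in>configs d T. (if \<forall>i\<in>T. a (n + i) = t i then of_real (sqrt (g t)) else 0)
        * cnj (if \<forall>i\<in>T. c (n + i) = t i then of_real (sqrt (g t)) else 0))"
      by (intro sum.cong refl) (auto simp: g complex_sqrt_mult_self)
    finally show ?thesis
      unfolding \<rho>_amplified[OF T ac] .
  qed
  show "(\<Sum>a\<in>configs d ((+) n ` T). cnj (if \<forall>i\<in>T. a (n + i) = s i then of_real (sqrt (g s)) else 0)
      * (if \<forall>i\<in>T. a (n + i) = t i then of_real (sqrt (g t)) else 0)) = (if s = t then of_real (g s) else 0)"
    if st: "s \<in> configs d T" "t \<in> configs d T" for s t
  proof -
    have inj: "s = t" if "\<forall>i\<in>T. s i = t i"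
    proof
      fix i show "s i = t i"
        using that st by (cases "i \<in> T") (auto simp: configs_def)
    qed
    \<comment> \<open>The detector configuration displaying \<open>s\<close>; among all
      configurations of the kept detectors it is the only one meeting the condition for
      \<open>s\<close>.\<close>
    define a\<^sub>s where "a\<^sub>s = (\<lambda>p. if p \<in> (+) n ` T then s (p - n) else 0)"
    have a\<^sub>s: "a\<^sub>s \<in> configs d ((+) n ` T)"
      using st by (auto simp: configs_def a\<^sub>s_def)
    have a\<^sub>s_iff: "(\<forall>i\<in>T. a (n + i) = s i) \<longleftrightarrow> a = a\<^sub>s" if "a \<in> configs d ((+) n ` T)" for a
    proof
      assume eq: "\<forall>i\<in>T. a (n + i) = s i"
      show "a = a\<^sub>s"
      proof
        fix p show "a p = a\<^sub>s p"
          using eq that by (cases "p \<in> (+) n ` T") (auto simp: configs_def a\<^sub>s_def)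
      qed
    qed (auto simp: a\<^sub>s_def)
    have t_iff: "(\<forall>i\<in>T. a\<^sub>s (n + i) = t i) \<longleftrightarrow> s = t"
      using inj by (auto simp: a\<^sub>s_def)
    have "(\<Sum>a\<in>configs d ((+) n ` T). cnj (if \<forall>i\<in>T. a (n + i) = s i then of_real (sqrt (g s)) else 0)
      * (if \<forall>i\<in>T. a (n + i) = t i then of_real (sqrt (g t)) else 0))
      = (\<Sum>a\<in>configs d ((+) n ` T). if a = a\<^sub>s then if s = t then of_real (g s) else 0 else 0)"
    proof (intro sum.cong refl)
      fix a assume a: "a \<in> configs d ((+) n ` T)"
      show "cnj (if \<forall>i\<in>T. a (n + i) = s i then of_real (sqrt (g s)) else 0)
        * (if \<forall>i\<in>T. a (n + i) = t i then of_real (sqrt (g t)) else 0)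
        = (if a = a\<^sub>s then if s = t then complex_of_real (g s) else 0 else 0)"
      proof (cases "a = a\<^sub>s")
        case True
        show ?thesis
          unfolding a\<^sub>s_iff[OF a] unfolding True t_iff using g by (simp add: complex_sqrt_mult_self)
      next
        case False
        then show ?thesis
          unfolding a\<^sub>s_iff[OF a] by simp
      qed
    qed
    also have "\<dots> = (if s = t then of_real (g s) else 0)"
      using a\<^sub>s T finite_subset[of T] by simp
    finally show ?thesis .
  qed
qed simp

lemma h_add_last:
  assumes "r \<in> configs d {1..n-1}"
  shows "h (\<lambda>p. r p + (if p = n then y else 0)) = \<phi> r * U (r (n-1)) y"
proof -
  have "r n = 0"
    using assms n by (auto simp: configs_def)
  then have "h (\<lambda>p. r p + (if p = n then y else 0)) = h (r(n := y))"
    by (intro h_local) auto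
  then show ?thesis
    by (simp add: h_upd)
qed

lemma ent_amplified_last: "ent d (2*n+1) \<psi>\<^sub>a {2*n} = - (\<Sum>y<d. p_last y * log d (p_last y))"
proof -
  have sets: "{n} \<subseteq> {1..n}" "(+) n ` {n} = {2*n}" "{1..n} - {n} = {1..n-1}"
    using n by auto
  have "(\<Sum>r\<in>configs d {1..n-1}. (cmod (h (\<lambda>p. (if p = n then y else 0) + r p)))\<^sup>2) = p_last y" for y
    unfolding p_last_def
  proof (intro sum.cong refl)
    fix r assume r: "r \<in> configs d {1..n-1}"
    show "(cmod (h (\<lambda>p. (if p = n then y else 0) + r p)))\<^sup>2 = (cmod (h (r(n := y))))\<^sup>2"
      using h_add_last[OF r, of y] by (simp add: add.commute h_upd)
  qed
  then show ?thesis
    using ent_amplified[OF sets(1)] unfolding sets by (simp add: sum_configs_singleton)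
qed

text \<open>The rows of \<open>U\<close> have norm 1, so summing out the last outcome leaves the
  squared modulus of \<open>\<phi>\<close>.\<close>

lemma ent_amplified_prev:
  "ent d (2*n+1) \<psi>\<^sub>a {n+1..2*n-1} = - (\<Sum>r\<in>configs d {1..n-1}. (cmod (\<phi> r))\<^sup>2 * log d ((cmod (\<phi> r))\<^sup>2))"
proof -
  have sets: "{1..n-1} \<subseteq> {1..n}" "(+) n ` {1..n-1} = {n+1..2*n-1}" "{1..n} - {1..n-1} = {n}"
    using n by (auto simp: mult_2)
  have "(\<Sum>k\<in>configs d {n}. (cmod (h (\<lambda>p. r p + k p)))\<^sup>2) = (cmod (\<phi> r))\<^sup>2" if r: "r \<in> configs d {1..n-1}" for r
  proof -
    have "r (n-1) < d"
      using r n by (auto simp: configs_def)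
    then show ?thesis
      by (simp add: sum_configs_singleton h_add_last[OF r] norm_mult power_mult_distrib U_row_norm flip: sum_distrib_left)
  qed
  then show ?thesis
    using ent_amplified[OF sets(1)] unfolding sets by simp
qed

lemma ent_amplified_all:
  "ent d (2*n+1) \<psi>\<^sub>a {n+1..2*n} = - (\<Sum>r\<in>configs d {1..n-1}. \<Sum>y<d.
     (cmod (\<phi> r))\<^sup>2 * (cmod (U (r (n-1)) y))\<^sup>2 * log d ((cmod (\<phi> r))\<^sup>2 * (cmod (U (r (n-1)) y))\<^sup>2))"
proof -
  have image: "(+) n ` {1..n} = {n+1..2*n}"
    by (simp add: mult_2)
  have split: "{1..n} = {1..n-1} \<union> {n}"
    using n by auto
  have "ent d (2*n+1) \<psi>\<^sub>a {n+1..2*n} = - (\<Sum>s\<in>configs d {1..n}. (cmod (h s))\<^sup>2 * log d ((cmod (h s))\<^sup>2))"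
    using ent_amplified[OF order_refl] unfolding image by simp
  also have "(\<Sum>s\<in>configs d {1..n}. (cmod (h s))\<^sup>2 * log d ((cmod (h s))\<^sup>2))
    = (\<Sum>r\<in>configs d {1..n-1}. \<Sum>k\<in>configs d {n}. (cmod (h (\<lambda>p. r p + k p)))\<^sup>2 * log d ((cmod (h (\<lambda>p. r p + k p)))\<^sup>2))"
    unfolding split using n by (subst sum_configs_Un) auto
  also have "\<dots> = (\<Sum>r\<in>configs d {1..n-1}. \<Sum>y<d.
     (cmod (\<phi> r))\<^sup>2 * (cmod (U (r (n-1)) y))\<^sup>2 * log d ((cmod (\<phi> r))\<^sup>2 * (cmod (U (r (n-1)) y))\<^sup>2))"
    by (intro sum.cong refl) (simp only: sum_configs_singleton h_add_last norm_mult power_mult_distrib)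
  finally show ?thesis .
qed

section \<open>Assembling the entropies\<close>

text \<open>The chain rule is applied to the full record and to the last two outcomes. Both give the
  same conditional entropy of the last outcome, so it cancels against the bound by the
  diagonal.\<close>

lemma mutual_info_bound:
  "mutual_info d (2*n+1) \<psi>\<^sub>a {2*n} {n+1..2*n-1}
    \<le> mutual_info d (2*n+1) \<psi>\<^sub>u {n} {1..n-1} - cond_ent d (2*n+1) \<psi>\<^sub>u {n-1} {n}"
  "cond_ent d (2*n+1) \<psi>\<^sub>u {n-1} {n} \<ge> 0"
proof -
  let ?A = "configs d {1..n-1}" and ?u = "\<lambda>x y. (cmod (U x y))\<^sup>2"
  \<comment> \<open>Minus the Shannon entropy of the transition probabilities out of
    \<open>x\<close>.\<close>
  define t where "t = (\<lambda>x. \<Sum>y<d. ?u x y * log d (?u x y))"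
  have unions: "{2*n} \<union> {n+1..2*n-1} = {n+1..2*n}" "{n} \<union> {1..n-1} = {1..n}"
    using n by auto
  have less: "r (n-1) < d" if "r \<in> ?A" for r
    using that n by (auto simp: configs_def)
  have row: "(\<Sum>y<d. q * ?u x y * log d (q * ?u x y)) = q * log d q + q * t x" if "q \<ge> 0" "x < d" for q x
    using that U_row_norm[of x]
    by (simp add: xlogx_mult sum.distrib t_def flip: sum_distrib_left sum_distrib_right)
  have p_prev_nonneg: "p_prev x \<ge> 0" for x
    by (simp add: p_prev_def sum_nonneg)
  \<comment> \<open>The conditional term depends on a record only through its last entry, so
    averaging over records reduces to averaging with \<open>p_prev\<close>.\<close>
  have mix: "(\<Sum>r\<in>?A. (cmod (\<phi> r))\<^sup>2 * t (r (n-1))) = (\<Sum>x<d. p_prev x * t x)"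
  proof -
    have "(\<Sum>x<d. p_prev x * t x) = (\<Sum>r\<in>?A. \<Sum>x<d. if x = r (n-1) then (cmod (\<phi> r))\<^sup>2 * t x else 0)"
      unfolding p_prev_def sum_distrib_right by (subst sum.swap) (intro sum.cong refl, auto)
    also have "\<dots> = (\<Sum>r\<in>?A. (cmod (\<phi> r))\<^sup>2 * t (r (n-1)))"
      by (intro sum.cong refl) (use less in simp)
    finally show ?thesis ..
  qed
  have amplified_all: "ent d (2*n+1) \<psi>\<^sub>a {n+1..2*n}
    = - (\<Sum>r\<in>?A. (cmod (\<phi> r))\<^sup>2 * log d ((cmod (\<phi> r))\<^sup>2)) - (\<Sum>x<d. p_prev x * t x)"
  proof -
    have "(\<Sum>r\<in>?A. \<Sum>y<d. (cmod (\<phi> r))\<^sup>2 * ?u (r (n-1)) y * log d ((cmod (\<phi> r))\<^sup>2 * ?u (r (n-1)) y))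
      = (\<Sum>r\<in>?A. (cmod (\<phi> r))\<^sup>2 * log d ((cmod (\<phi> r))\<^sup>2) + (cmod (\<phi> r))\<^sup>2 * t (r (n-1)))"
      by (intro sum.cong refl row less) auto
    then show ?thesis
      unfolding ent_amplified_all sum.distrib mix by simp
  qed
  have "(\<Sum>y<d. \<Sum>x<d. p_prev x * ?u x y * log d (p_prev x * ?u x y))
    = (\<Sum>x<d. p_prev x * log d (p_prev x)) + (\<Sum>x<d. p_prev x * t x)"
    by (subst sum.swap) (simp add: row p_prev_nonneg sum.distrib)
  then have "ent d (2*n+1) \<psi>\<^sub>u ({n-1} \<union> {n})
      \<le> - (\<Sum>x<d. p_prev x * log d (p_prev x)) - (\<Sum>x<d. p_prev x * t x)"
    using ent_last_two_bounds(2) by simp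
  then show "mutual_info d (2*n+1) \<psi>\<^sub>a {2*n} {n+1..2*n-1}
    \<le> mutual_info d (2*n+1) \<psi>\<^sub>u {n} {1..n-1} - cond_ent d (2*n+1) \<psi>\<^sub>u {n-1} {n}"
    unfolding mutual_info_def cond_ent_def unions amplified_all ent_amplified_last ent_amplified_prev
      ent_last ent_prev ent_all by linarith
  show "cond_ent d (2*n+1) \<psi>\<^sub>u {n-1} {n} \<ge> 0"
    unfolding cond_ent_def ent_last using ent_last_two_bounds(1) by linarith
qed

end

section \<open>Instantiation at the given measurement bases\<close>

theorem theorem6:
  fixes d n :: nat and \<alpha> :: "nat \<Rightarrow> complex" and b :: "nat \<Rightarrow> nat \<Rightarrow> nat \<Rightarrow> complex"
  assumes "d \<ge> 2" and "n \<ge> 2"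
    and orth: "\<forall>i\<in>{1..n}. \<forall>x<d. \<forall>y<d. (\<Sum>q<d. cnj (b i x q) * b i y q) = (if x = y then 1 else 0)"
    and norm: "(\<Sum>x<d. (cmod (\<alpha> x))\<^sup>2) = 1"
  shows "mutual_info d (2*n+1) (amplified d n \<alpha> b) {2*n} {n+1..2*n-1}
           \<le> mutual_info d (2*n+1) (unamplified d n \<alpha> b) {n} {1..n-1}
              - cond_ent d (2*n+1) (unamplified d n \<alpha> b) {n-1} {n}
       \<and> cond_ent d (2*n+1) (unamplified d n \<alpha> b) {n-1} {n} \<ge> 0"
proof -
  \<comment> \<open>All factors of the amplitude except the last basis change; for
    \<open>n = 2\<close> the product is empty.\<close>
  define \<phi> where "\<phi> = (\<lambda>c :: nat \<Rightarrow> nat. \<alpha> (c 1) * (\<Prod>i\<in>{2..n-1}. Umat d b i (c (i - 1)) (c i)))"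
  have b_last: "(\<Sum>q<d. cnj (b n x q) * b n y q) = (if x = y then 1 else 0)" if "x < d" "y < d" for x y
    using orth \<open>n \<ge> 2\<close> that by auto
  have b_prev: "(\<Sum>q<d. cnj (b (n-1) x q) * b (n-1) y q) = (if x = y then 1 else 0)" if "x < d" "y < d" for x y
    using orth \<open>n \<ge> 2\<close> that by auto
  interpret last_measurement d n \<phi> "Umat d b n" "b n"
  proof
    fix c c' :: "nat \<Rightarrow> nat"
    assume eq: "\<And>i. i \<in> {1..n-1} \<Longrightarrow> c i = c' i"
    have "c 1 = c' 1"
      using \<open>n \<ge> 2\<close> by (intro eq) auto
    moreover have "Umat d b i (c (i - 1)) (c i) = Umat d b i (c' (i - 1)) (c' i)" if "i \<in> {2..n-1}" for i
      using that by (intro arg_cong2[where f="Umat d b i"] eq) auto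
    then have "(\<Prod>i\<in>{2..n-1}. Umat d b i (c (i - 1)) (c i)) = (\<Prod>i\<in>{2..n-1}. Umat d b i (c' (i - 1)) (c' i))"
      by (rule prod.cong[OF refl])
    ultimately show "\<phi> c = \<phi> c'"
      by (simp only: \<phi>_def)
  next
    fix x y assume xy: "x < d" "y < d"
    \<comment> \<open>The sum over \<open>z\<close> is resolved by completeness of the last basis,
      and orthonormality of the previous basis does the rest.\<close>
    have "(\<Sum>z<d. Umat d b n x z * cnj (Umat d b n y z))
      = (\<Sum>z<d. \<Sum>q<d. \<Sum>q'<d. (b (n-1) x q * cnj (b (n-1) y q')) * (b n z q' * cnj (b n z q)))"
      unfolding Umat_def cnj_sum sum_product by (simp add: ac_simps)
    also have "\<dots> = (\<Sum>q<d. \<Sum>q'<d. (b (n-1) x q * cnj (b (n-1) y q')) * (\<Sum>z<d. b n z q' * cnj (b n z q)))"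
      unfolding sum_distrib_left by (subst sum.swap, rule sum.cong[OF refl sum.swap])
    also have "\<dots> = (\<Sum>q<d. \<Sum>q'<d. (b (n-1) x q * cnj (b (n-1) y q')) * (if q' = q then 1 else 0))"
      by (intro sum.cong refl arg_cong2[where f="(*)"] orthonormal_complete[of d "b n", OF b_last]) auto
    also have "\<dots> = (\<Sum>q<d. cnj (b (n-1) y q) * b (n-1) x q)"
      by (intro sum.cong refl) (simp add: if_distrib mult.commute cong: if_cong)
    also have "\<dots> = (if x = y then 1 else 0)"
      using b_prev[OF xy(2,1)] by auto
    finally show "(\<Sum>z<d. Umat d b n x z * cnj (Umat d b n y z)) = (if x = y then 1 else 0)" .
  qed (use assms b_last in auto)
  have amp: "amp d n \<alpha> b c = h c * b n (c n) (c 0)" for c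
  proof -
    have "{2..n} = insert n {2..n-1}" "n \<notin> {2..n-1}"
      using \<open>n \<ge> 2\<close> by auto
    then show ?thesis
      unfolding h_def by (simp add: amp_def \<phi>_def ac_simps)
  qed
  have "unamplified d n \<alpha> b = \<psi>\<^sub>u" "amplified d n \<alpha> b = \<psi>\<^sub>a"
    by (auto simp: unamplified_def amplified_def \<psi>\<^sub>u_def \<psi>\<^sub>a_def amp)
  then show ?thesis
    using mutual_info_bound by simp
qed

end
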